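(* Assume that $P(x,y)>0$ for all $x,y\in X$ and that there is a constant $C_*\ge 1$ with $P_2(x,y)\le C_*P(x,y)$ for all $x,y\in X$; that $\sup_{x,y\in X}P(x,y)/\mu(y)<\infty$; and that the potential $V$ is confining. Then the following statements hold. (a) If $n_0\in\mathbb N$ and $(A_n)$ is an exhausting sequence for which both semigroups $\{\mathcal U_n:n\in\mathbb N_0\}$, $\{\widehat{\mathcal U}_n:n\in\mathbb N_0\}$ are pIUC($n_0$), then there exist $C_1,C_2>0$ and $\rho\in(0,1)$ such that for all $n>2n_0+1$ and all $k,l,j\in\mathbb N_0$ such that $l,j\ge n_0$ and $k+l+j=n-1$ we have $$\sup_{x\in A_l}\ \sup_{\|f\|_{\ell^1(\nu)}\le1}\big|\mathcal Q_nf(x)-\bar\nu(f)\big|\le C_1\left(\sup_{z\in A_j^c}\frac1{V(z)}+\rho^k\right)$$ and $$\sup_{x\in A_l}\ \sup_{\|f\|_{\ell^1(m)}\le1}\left|\frac{\mathcal U_nf(x)}{\mathcal U_n\mathbf 1(x)}-m(f)\right|\le C_2\left(\sup_{z\in A_j^c}\frac1{V(z)}+\rho^k\right).$$ These assertions remain valid in the dual setting, i.e. if one replaces $\mathcal Q_n$ with $\widehat{\mathcal Q}_n$ in the first estimate, and $\mathcal U_n$ and $m$ with $\widehat{\mathcal U}_n$ and $\widehat m$ in the second. (b) If there is an exhausting sequence $(A_n)$ such that $$\lim_{n\to\infty}\ \sup_{x\in A_n}\ \sup_{\|f\|_{\ell^1(\nu)}\le1}\big|\mathcal Q_nf(x)-\bar\nu(f)\big|=0$$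 or $$\lim_{n\to\infty}\ \sup_{x\in A_n}\ \sup_{\|f\|_{\ell^1(m)}\le1}\left|\frac{\mathcal U_nf(x)}{\mathcal U_n\mathbf 1(x)}-m(f)\right|=0$$ holds, then the semigroup $\{\mathcal U_n:n\in\mathbb N_0\}$ is pIUC with respect to the exhaustion $(A_{n-1})_{n\in\mathbb N}$ (where $A_0:=\emptyset$). This assertion remains true if one replaces $\mathcal Q_n,\mathcal U_n,m$ with $\widehat{\mathcal Q}_n,\widehat{\mathcal U}_n,\widehat m$.
   Context: $X$ is a countably infinite set, $\mathbb N=\{1,2,\dots\}$, $\mathbb N_0=\mathbb N\cup\{0\}$, $\mathbf 1$ is the constant function $1$. The supremum of $1/V$ over the empty set is understood as $0$. $P:X\times X\to[0,1]$ is a (sub-)probability kernel, i.e. $\sum_{y\in X}P(x,y)\le1$ for all $x$. It is assumed throughout that there are a (sub-)probability kernel $\widehat P:X\times X\to[0,1]$ and a measure $\mu:X\to(0,\infty)$ with $\mu(x)P(x,y)=\mu(y)\widehat P(y,x)$ for all $x,y\in X$. Put $p(x,y)=P(x,y)/\mu(y)$ and $P_2(x,y)=\sum_{z\in X}P(x,z)P(z,y)$. A potential is a function $V:X\to(0,\infty)$ with $\inf_{x\in X}V(x)>0$ (standing assumption). It is confining if for every $M\in\mathbb N$ there is a finite set $B_M\subset X$ with $V(x)\ge M$ for all $x\in X\setminus B_M$. Let $\mathcal U f(x)=\frac1{V(x)}\sum_{y}P(x,y)f(y)$ and $\widehat{\mathcal U}f(x)=\sum_y\widehat P(x,y)\frac1{V(y)}f(y)$;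 these are mutually adjoint on $\ell^2(\mu)$. Let $\mathcal U_n=\mathcal U^n$, $\widehat{\mathcal U}_n=\widehat{\mathcal U}^n$, with kernels with respect to $\mu$ given by $u_1(x,y)=p(x,y)/V(x)$, $u_{n+1}(x,y)=\sum_zu_n(x,z)u_1(z,y)\mu(z)$ and $\widehat u_n(x,y)=u_n(y,x)$. Under the hypotheses of the claim, $\mathcal U,\widehat{\mathcal U}$ are compact on $\ell^2(\mu)$ and $\lambda_0:=\sup_{\lambda\in\sigma(\mathcal U)}|\lambda|=\sup_{\lambda\in\sigma(\widehat{\mathcal U})}|\lambda|>0$ is a simple eigenvalue of both; $\varphi_0,\widehat\varphi_0$ denote the corresponding strictly positive eigenfunctions, $\mathcal U\varphi_0=\lambda_0\varphi_0$, $\widehat{\mathcal U}\widehat\varphi_0=\lambda_0\widehat\varphi_0$, normalized by $\|\varphi_0\|_{\ell^2(\mu)}=\|\widehat\varphi_0\|_{\ell^2(\mu)}=1$. Moreover $\varphi_0,\widehat\varphi_0\in\ell^1(\mu)\cap\ell^\infty(\mu)$. Let $\nu(x)=\varphi_0(x)\widehat\varphi_0(x)\mu(x)$, a finite measure with total mass $\|\nu\|=\sum_x\nu(x)$, and $\bar\nu(f)=\frac1{\|\nu\|}\sum_yf(y)\nu(y)$. The intrinsic semigroups are $\mathcal Q_nf=\lambda_0^{-n}\varphi_0^{-1}\,\mathcal U_n(f\varphi_0)$ and $\widehat{\mathcal Q}_nf=\lambda_0^{-n}\widehat\varphi_0^{-1}\,\widehat{\mathcal U}_n(f\widehat\varphi_0)$.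 The probability measures $m,\widehat m$ are $m(x)=\widehat\varphi_0(x)\mu(x)/\|\widehat\varphi_0\|_{\ell^1(\mu)}$ and $\widehat m(x)=\varphi_0(x)\mu(x)/\|\varphi_0\|_{\ell^1(\mu)}$, with $m(f)=\sum_xf(x)m(x)$ and similarly for $\widehat m$. A sequence $(A_n)_{n\in\mathbb N}$ of subsets of $X$ is exhausting if $A_n\subseteq A_{n+1}$ and $\bigcup_nA_n=X$. $\{\mathcal U_n\}$ is pIUC($n_0$) (progressively intrinsically ultracontractive) with respect to an exhausting sequence $(A_n)$ if there is $c>0$ with $u_n(x,y)\le c\lambda_0^n\varphi_0(x)\widehat\varphi_0(y)$ for all $n\ge n_0$, $x\in A_n$, $y\in X$; $\{\widehat{\mathcal U}_n\}$ is pIUC($n_0$) if there is $c>0$ with $\widehat u_n(x,y)\le c\lambda_0^n\widehat\varphi_0(x)\varphi_0(y)$ for all $n\ge n_0$, $x\in A_n$, $y\in X$. "pIUC" means pIUC($n_0$) for some $n_0\in\mathbb N$. *)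

theory Defs
  imports "HOL-Analysis.Analysis"
begin

text \<open>The countably infinite set \<open>X\<close> is the universe of the type \<open>'a\<close>. All possibly infinite
  sums are unordered sums (\<open>infsum\<close>), which have the junk value 0 when they do not converge;
  summability is therefore required explicitly in definitions that are used as hypotheses.
  Suprema that need not be finite, or that may range over an empty set, are taken in \<open>ennreal\<close>,
  where the supremum of the empty set is 0.\<close>

definition subprob_kernel :: "('a \<Rightarrow> 'a \<Rightarrow> real) \<Rightarrow> bool" where
  "subprob_kernel P \<longleftrightarrow>
     (\<forall>x y. 0 \<le> P x y \<and> P x y \<le> 1) \<and>
     (\<forall>x. P x summable_on UNIV \<and> (\<Sum>\<^sub>\<infinity>y. P x y) \<le> 1)"

definition kernel_comp2 :: "('a \<Rightarrow> 'a \<Rightarrow> real) \<Rightarrow> 'a \<Rightarrow> 'a \<Rightarrow> real" where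
  "kernel_comp2 P x y = (\<Sum>\<^sub>\<infinity>z. P x z * P z y)"

definition potential :: "('a \<Rightarrow> real) \<Rightarrow> bool" where
  "potential V \<longleftrightarrow> (\<forall>x. 0 < V x) \<and> 0 < (INF x. V x)"

definition confining :: "('a \<Rightarrow> real) \<Rightarrow> bool" where
  "confining V \<longleftrightarrow> (\<forall>M::nat. 1 \<le> M \<longrightarrow> (\<exists>B. finite B \<and> (\<forall>x. x \<notin> B \<longrightarrow> real M \<le> V x)))"

text \<open>The operators act on vector-valued functions so that the same definition serves for
  complex-valued functions (for the spectrum) and for real-valued ones.\<close>

definition fk_op ::
  "('a \<Rightarrow> 'a \<Rightarrow> real) \<Rightarrow> ('a \<Rightarrow> real) \<Rightarrow> ('a \<Rightarrow> 'b::real_normed_vector) \<Rightarrow> 'a \<Rightarrow> 'b" where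
  "fk_op P V f x = (1 / V x) *\<^sub>R (\<Sum>\<^sub>\<infinity>y. P x y *\<^sub>R f y)"

definition fk_op_dual ::
  "('a \<Rightarrow> 'a \<Rightarrow> real) \<Rightarrow> ('a \<Rightarrow> real) \<Rightarrow> ('a \<Rightarrow> 'b::real_normed_vector) \<Rightarrow> 'a \<Rightarrow> 'b" where
  "fk_op_dual Phat V f x = (\<Sum>\<^sub>\<infinity>y. (Phat x y * (1 / V y)) *\<^sub>R f y)"

text \<open>The kernel of the \<open>n\<close>-th power with respect to \<open>\<mu>\<close>; the value at \<open>n = 0\<close> is the kernel of
  the identity.\<close>

fun fk_kernel ::
  "('a \<Rightarrow> 'a \<Rightarrow> real) \<Rightarrow> ('a \<Rightarrow> real) \<Rightarrow> ('a \<Rightarrow> real) \<Rightarrow> nat \<Rightarrow> 'a \<Rightarrow> 'a \<Rightarrow> real" where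
  "fk_kernel P \<mu> V 0 x y = (if x = y then 1 / \<mu> y else 0)"
| "fk_kernel P \<mu> V (Suc 0) x y = (P x y / \<mu> y) / V x"
| "fk_kernel P \<mu> V (Suc (Suc n)) x y =
     (\<Sum>\<^sub>\<infinity>z. fk_kernel P \<mu> V (Suc n) x z * fk_kernel P \<mu> V (Suc 0) z y * \<mu> z)"

definition fk_kernel_dual ::
  "('a \<Rightarrow> 'a \<Rightarrow> real) \<Rightarrow> ('a \<Rightarrow> real) \<Rightarrow> ('a \<Rightarrow> real) \<Rightarrow> nat \<Rightarrow> 'a \<Rightarrow> 'a \<Rightarrow> real" where
  "fk_kernel_dual P \<mu> V n x y = fk_kernel P \<mu> V n y x"

definition l2 :: "('a \<Rightarrow> real) \<Rightarrow> ('a \<Rightarrow> 'b::real_normed_vector) set" where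
  "l2 \<mu> = {f. (\<lambda>x. (norm (f x))\<^sup>2 * \<mu> x) summable_on UNIV}"

definition l2_norm :: "('a \<Rightarrow> real) \<Rightarrow> ('a \<Rightarrow> 'b::real_normed_vector) \<Rightarrow> real" where
  "l2_norm \<mu> f = sqrt (\<Sum>\<^sub>\<infinity>x. (norm (f x))\<^sup>2 * \<mu> x)"

definition bounded_op_l2 ::
  "('a \<Rightarrow> real) \<Rightarrow> (('a \<Rightarrow> complex) \<Rightarrow> 'a \<Rightarrow> complex) \<Rightarrow> bool" where
  "bounded_op_l2 \<mu> T \<longleftrightarrow>
     (\<forall>f\<in>l2 \<mu>. T f \<in> l2 \<mu>) \<and>
     (\<forall>f\<in>l2 \<mu>. \<forall>g\<in>l2 \<mu>. \<forall>a b. T (\<lambda>x. a * f x + b * g x) = (\<lambda>x. a * T f x + b * T g x)) \<and>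
     (\<exists>C. \<forall>f\<in>l2 \<mu>. l2_norm \<mu> (T f) \<le> C * l2_norm \<mu> f)"

definition spectrum_l2 ::
  "('a \<Rightarrow> real) \<Rightarrow> (('a \<Rightarrow> complex) \<Rightarrow> 'a \<Rightarrow> complex) \<Rightarrow> complex set" where
  "spectrum_l2 \<mu> T = {z. \<not> (\<exists>R. bounded_op_l2 \<mu> R \<and>
     (\<forall>f\<in>l2 \<mu>. R (\<lambda>x. z * f x - T f x) = f \<and> (\<lambda>x. z * R f x - T (R f) x) = f))}"

definition spectral_radius_l2 ::
  "('a \<Rightarrow> real) \<Rightarrow> (('a \<Rightarrow> complex) \<Rightarrow> 'a \<Rightarrow> complex) \<Rightarrow> real" where
  "spectral_radius_l2 \<mu> T = (SUP z\<in>spectrum_l2 \<mu> T. norm z)"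

text \<open>A strictly positive eigenfunction normalized in the norm of \<open>l2 \<mu>\<close>.\<close>

definition positive_eigenfunction ::
  "('a \<Rightarrow> real) \<Rightarrow> (('a \<Rightarrow> real) \<Rightarrow> 'a \<Rightarrow> real) \<Rightarrow> real \<Rightarrow> ('a \<Rightarrow> real) \<Rightarrow> bool" where
  "positive_eigenfunction \<mu> T lam0 \<phi> \<longleftrightarrow>
     \<phi> \<in> l2 \<mu> \<and> l2_norm \<mu> \<phi> = 1 \<and> (\<forall>x. 0 < \<phi> x) \<and> (\<forall>x. T \<phi> x = lam0 * \<phi> x)"

definition l1_norm :: "('a \<Rightarrow> real) \<Rightarrow> ('a \<Rightarrow> real) \<Rightarrow> real" where
  "l1_norm w f = (\<Sum>\<^sub>\<infinity>x. \<bar>f x\<bar> * w x)"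

definition l1_ball :: "('a \<Rightarrow> real) \<Rightarrow> ('a \<Rightarrow> real) set" where
  "l1_ball w = {f. (\<lambda>x. \<bar>f x\<bar> * w x) summable_on UNIV \<and> l1_norm w f \<le> 1}"

definition nu_meas :: "('a \<Rightarrow> real) \<Rightarrow> ('a \<Rightarrow> real) \<Rightarrow> ('a \<Rightarrow> real) \<Rightarrow> 'a \<Rightarrow> real" where
  "nu_meas \<mu> \<phi> \<phi>hat x = \<phi> x * \<phi>hat x * \<mu> x"

definition mean :: "('a \<Rightarrow> real) \<Rightarrow> ('a \<Rightarrow> real) \<Rightarrow> real" where
  "mean \<nu> f = (1 / (\<Sum>\<^sub>\<infinity>x. \<nu> x)) * (\<Sum>\<^sub>\<infinity>y. f y * \<nu> y)"

text \<open>With \<open>\<psi>\<close> the eigenfunction of the dual (respectively of the original) operator this is the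
  probability measure \<open>m\<close> (respectively \<open>mhat\<close>).\<close>

definition qs_meas :: "('a \<Rightarrow> real) \<Rightarrow> ('a \<Rightarrow> real) \<Rightarrow> 'a \<Rightarrow> real" where
  "qs_meas \<mu> \<psi> x = \<psi> x * \<mu> x / l1_norm \<mu> \<psi>"

definition intrinsic ::
  "(('a \<Rightarrow> real) \<Rightarrow> 'a \<Rightarrow> real) \<Rightarrow> real \<Rightarrow> ('a \<Rightarrow> real) \<Rightarrow> nat \<Rightarrow> ('a \<Rightarrow> real) \<Rightarrow> 'a \<Rightarrow> real" where
  "intrinsic T lam0 \<phi> n f x = (1 / lam0 ^ n) * (1 / \<phi> x) * (T ^^ n) (\<lambda>y. f y * \<phi> y) x"

text \<open>The two left-hand sides: the uniform distance over \<open>x \<in> A\<close> of the intrinsic semigroup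
  to its stationary mean, and of the normalized semigroup to the quasi-stationary measure.\<close>

definition intrinsic_dist ::
  "(('a \<Rightarrow> real) \<Rightarrow> 'a \<Rightarrow> real) \<Rightarrow> real \<Rightarrow> ('a \<Rightarrow> real) \<Rightarrow> ('a \<Rightarrow> real) \<Rightarrow> nat \<Rightarrow> 'a set \<Rightarrow> ennreal" where
  "intrinsic_dist T lam0 \<phi> \<nu> n A =
     (SUP x\<in>A. SUP f\<in>l1_ball \<nu>. ennreal \<bar>intrinsic T lam0 \<phi> n f x - mean \<nu> f\<bar>)"

definition qs_dist ::
  "(('a \<Rightarrow> real) \<Rightarrow> 'a \<Rightarrow> real) \<Rightarrow> ('a \<Rightarrow> real) \<Rightarrow> nat \<Rightarrow> 'a set \<Rightarrow> ennreal" where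
  "qs_dist T m n A =
     (SUP x\<in>A. SUP f\<in>l1_ball m.
        ennreal \<bar>(T ^^ n) f x / (T ^^ n) (\<lambda>_. 1) x - (\<Sum>\<^sub>\<infinity>y. f y * m y)\<bar>)"

text \<open>Sequences indexed by the positive integers are functions on \<open>nat\<close> whose value at 0 is
  irrelevant.\<close>

definition exhausting :: "(nat \<Rightarrow> 'a set) \<Rightarrow> bool" where
  "exhausting A \<longleftrightarrow> (\<forall>n\<ge>1. A n \<subseteq> A (Suc n)) \<and> (\<Union>n\<in>{1..}. A n) = UNIV"

text \<open>Here \<open>u\<close> is the family of kernels; for the dual semigroup \<open>u\<close> is the dual family and the roles
  of \<open>\<phi>\<close> and \<open>\<psi>\<close> are interchanged.\<close>

definition pIUC_from ::
  "(nat \<Rightarrow> 'a \<Rightarrow> 'a \<Rightarrow> real) \<Rightarrow> real \<Rightarrow> ('a \<Rightarrow> real) \<Rightarrow> ('a \<Rightarrow> real) \<Rightarrow> (nat \<Rightarrow> 'a set) \<Rightarrow> nat \<Rightarrow> bool" where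
  "pIUC_from u lam0 \<phi> \<psi> A n0 \<longleftrightarrow>
     (\<exists>c>0. \<forall>n\<ge>n0. \<forall>x\<in>A n. \<forall>y. u n x y \<le> c * lam0 ^ n * \<phi> x * \<psi> y)"

definition pIUC ::
  "(nat \<Rightarrow> 'a \<Rightarrow> 'a \<Rightarrow> real) \<Rightarrow> real \<Rightarrow> ('a \<Rightarrow> real) \<Rightarrow> ('a \<Rightarrow> real) \<Rightarrow> (nat \<Rightarrow> 'a set) \<Rightarrow> bool" where
  "pIUC u lam0 \<phi> \<psi> A \<longleftrightarrow> (\<exists>n0\<ge>1. pIUC_from u lam0 \<phi> \<psi> A n0)"

text \<open>The sequence \<open>A (n - 1)\<close>, \<open>n \<ge> 1\<close>, with \<open>A 0\<close> replaced by the empty set.\<close>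

definition shift_exhaustion :: "(nat \<Rightarrow> 'a set) \<Rightarrow> nat \<Rightarrow> 'a set" where
  "shift_exhaustion A n = (if n \<le> 1 then {} else A (n - 1))"

end

theory Submission
  imports Defs
begin

text \<open>After an \<open>h\<close>-transform with the eigenfunctions the semigroup becomes a Markov chain with
  stationary measure \<open>\<nu>\<close>. The hypothesis \<open>P\<^sub>2 \<le> C\<^sub>* P\<close> says that passing through a set \<open>S\<close> between
  two steps costs a factor \<open>C\<^sub>* sup\<^sub>S 1/V\<close> relative to the direct step. As \<open>V\<close> is confining, from any
  starting point the chain therefore lies in a fixed finite set after one step with probability at
  least one half, and comparing with a fixed point \<open>y\<close> gives a Doeblin minorization
  \<open>u\<^sub>1(x, y) \<ge> c \<phi>\<^sub>0(x)\<close> uniform in \<open>x\<close>. Hence the oscillation of \<open>f/\<phi>\<^sub>0\<close> contracts geometrically, with no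
  appeal to compactness or to a spectral gap; the same minorization gives the boundedness and
  summability of the eigenfunctions.

  For (a), the last step of \<open>u\<^sub>n\<close> is split according to whether the penultimate point lies in \<open>A\<^sub>j\<close>.
  There, dual pIUC bounds \<open>u\<^sub>j\<close> and the contraction applies to the remaining steps; off \<open>A\<^sub>j\<close> the step
  costs a factor \<open>sup 1/V\<close> relative to \<open>u\<^sub>n\<^sub>-\<^sub>1\<close>, which pIUC controls. For (b), point masses and \<open>\<phi>\<^sub>0\<close>
  are used as test functions.\<close>

section \<open>Unordered sums of real functions\<close>

text \<open>For real families summability is absolute, so the two hypotheses give summability on the
  product. Absolute control matters because \<open>infsum\<close> is 0 on divergent
  families.\<close>

lemma fubini_real:
  fixes h :: "'a \<Rightarrow> 'b \<Rightarrow> real"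
  assumes "\<And>x. h x summable_on UNIV" and "(\<lambda>x. \<Sum>\<^sub>\<infinity>y. \<bar>h x y\<bar>) summable_on UNIV"
  shows "(\<Sum>\<^sub>\<infinity>x. \<Sum>\<^sub>\<infinity>y. h x y) = (\<Sum>\<^sub>\<infinity>y. \<Sum>\<^sub>\<infinity>x. h x y)"
    and "(\<lambda>y. \<Sum>\<^sub>\<infinity>x. h x y) summable_on UNIV"
proof -
  have "(\<lambda>p. norm (case p of (x, y) \<Rightarrow> h x y)) summable_on (UNIV \<times> UNIV)"
    using assms summable_on_iff_abs_summable_on_real[of "h x" UNIV for x]
    by (subst Infinite_Sum.abs_summable_on_Sigma_iff) (simp add: infsum_nonneg)
  then have *: "(\<lambda>(x, y). h x y) summable_on (UNIV \<times> UNIV)"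
    by (rule abs_summable_summable)
  then have swapped: "(\<lambda>(y, x). h x y) summable_on (UNIV \<times> UNIV)"
    by (subst (asm) summable_on_swap) (simp add: case_prod_unfold)
  show "(\<Sum>\<^sub>\<infinity>x. \<Sum>\<^sub>\<infinity>y. h x y) = (\<Sum>\<^sub>\<infinity>y. \<Sum>\<^sub>\<infinity>x. h x y)"
    using infsum_swap_banach[OF *] .
  show "(\<lambda>y. \<Sum>\<^sub>\<infinity>x. h x y) summable_on UNIV"
    using summable_on_Sigma_banach[OF swapped] by simp
qed

lemma summable_on_real_bound:
  fixes f g :: "'a \<Rightarrow> real"
  assumes "g summable_on A" and "\<And>x. x \<in> A \<Longrightarrow> \<bar>f x\<bar> \<le> g x"
  shows "f summable_on A"
  using Infinite_Sum.abs_summable_on_comparison_test'[OF assms(1), of f] assms(2)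
  by (auto intro: abs_summable_summable)

lemma infsum_single:
  fixes f :: "'a \<Rightarrow> real"
  assumes "\<And>x. x \<noteq> a \<Longrightarrow> f x = 0"
  shows "f summable_on UNIV" and "(\<Sum>\<^sub>\<infinity>x. f x) = f a"
proof -
  have "(f has_sum f a) UNIV"
    using has_sum_finite[of "{a}" f] assms
    by (subst has_sum_cong_neutral[where T = "{a}" and g = f]) auto
  then show "f summable_on UNIV" "(\<Sum>\<^sub>\<infinity>x. f x) = f a"
    by (auto simp: has_sum_iff)
qed

lemma le_infsum_nonneg:
  fixes f :: "'a \<Rightarrow> real"
  assumes "f summable_on UNIV" and "\<And>x. 0 \<le> f x"
  shows "f a \<le> (\<Sum>\<^sub>\<infinity>x. f x)"
  using finite_sum_le_infsum[OF assms(1), of "{a}"] assms(2) by simp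

lemma has_sum_real_diff:
  fixes f g :: "'a \<Rightarrow> real"
  assumes "(f has_sum a) A" "(g has_sum b) A"
  shows "((\<lambda>x. f x - g x) has_sum a - b) A"
  using has_sum_add[OF assms(1), of "\<lambda>x. - g x" "- b"] assms(2) by (simp add: has_sum_uminus)

lemma has_sum_abs_le:
  fixes f g :: "'a \<Rightarrow> real"
  assumes "(g has_sum b) A" and "\<And>x. \<bar>f x\<bar> \<le> g x" and "(f has_sum a) A"
  shows "\<bar>a\<bar> \<le> b"
proof -
  have "a \<le> b"
    using assms by (intro has_sum_mono[OF assms(3) assms(1)]) (simp add: abs_le_iff)
  moreover have "- a \<le> b"
    using assms by (intro has_sum_mono[of "\<lambda>x. - f x" A "- a" g b]) (simp_all add: abs_le_iff has_sum_uminus)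
  ultimately show ?thesis by simp
qed

section \<open>Kernels with a pair of positive eigenfunctions\<close>

text \<open>The kernel \<open>K\<close>, taken with respect to \<open>\<mu>\<close>, stands for \<open>u\<^sub>1\<close> or for its transpose, and \<open>W\<close>
  for \<open>1 / V\<close>. The bound \<open>two_step\<close> is the only trace of \<open>P\<^sub>2 \<le> C\<^sub>* P\<close>; it reads the same for both
  kernels although they carry the factor \<open>1 / V\<close> in different arguments, so that every lemma has a
  dual.\<close>

locale eigen_kernel =
  fixes K :: "'a \<Rightarrow> 'a \<Rightarrow> real" and \<mu> W :: "'a \<Rightarrow> real" and C M lam :: real
    and \<phi> \<psi> :: "'a \<Rightarrow> real"
  assumes mu_pos: "0 < \<mu> x"
    and W_pos: "0 < W x"
    and finite_W: "0 < e \<Longrightarrow> finite {x. e \<le> W x}"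
    and C_pos: "0 < C"
    and K_pos: "0 < K x y"
    and K_le: "K x y \<le> M"
    and row_summable: "(\<lambda>y. K x y * \<mu> y) summable_on UNIV"
    and col_summable: "(\<lambda>x. K x y * \<mu> x) summable_on UNIV"
    and two_step: "\<lbrakk>\<And>w. w \<in> S \<Longrightarrow> W w \<le> s; 0 \<le> s\<rbrakk>
      \<Longrightarrow> (\<Sum>\<^sub>\<infinity>w\<in>S. K x w * K w y * \<mu> w) \<le> C * s * K x y"
    and phi_pos: "0 < \<phi> x"
    and psi_pos: "0 < \<psi> x"
    and phi_eigen: "((\<lambda>y. K x y * \<phi> y * \<mu> y) has_sum lam * \<phi> x) UNIV"
    and psi_eigen: "((\<lambda>x. K x y * \<psi> x * \<mu> x) has_sum lam * \<psi> y) UNIV"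
    and phi_psi_summable: "(\<lambda>x. \<phi> x * \<psi> x * \<mu> x) summable_on UNIV"
begin

text \<open>Transposition exchanges rows with columns and \<open>\<phi>\<close> with
  \<open>\<psi>\<close>, while the product in \<open>two_step\<close> only has its two factors
  interchanged.\<close>

lemma dual: "eigen_kernel (\<lambda>x y. K y x) \<mu> W C M lam \<psi> \<phi>"
proof
  fix S s x y
  assume "\<And>w. w \<in> S \<Longrightarrow> W w \<le> s" "0 \<le> (s::real)"
  then show "(\<Sum>\<^sub>\<infinity>w\<in>S. K w x * K y w * \<mu> w) \<le> C * s * K y x"
    using two_step[of S s y x] by (simp add: mult_ac)
qed (use mu_pos W_pos finite_W C_pos K_pos K_le row_summable col_summable phi_pos psi_pos phi_eigen
      psi_eigen phi_psi_summable in \<open>simp_all add: mult_ac\<close>)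

lemma lam_pos: "0 < lam"
proof -
  fix x
  have "0 < K x x * \<phi> x * \<mu> x"
    using K_pos phi_pos mu_pos by simp
  also have "\<dots> \<le> (\<Sum>\<^sub>\<infinity>y. K x y * \<phi> y * \<mu> y)"
    using phi_eigen[of x] K_pos phi_pos mu_pos
    by (intro le_infsum_nonneg) (auto simp: has_sum_iff less_imp_le)
  also have "\<dots> = lam * \<phi> x"
    using phi_eigen by (simp add: has_sum_iff)
  finally show ?thesis
    using phi_pos[of x] by (simp add: zero_less_mult_iff)
qed

section \<open>The operator and its invariant functional\<close>

text \<open>The l1 space of the measure \<open>\<psi> * \<mu>\<close>, summability of reals being
  absolute. It is the common domain on which all sums defining \<open>T\<close> and its powers
  converge.\<close>

definition L :: "('a \<Rightarrow> real) set" where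
  "L = {f. (\<lambda>x. f x * \<psi> x * \<mu> x) summable_on UNIV}"

definition I :: "('a \<Rightarrow> real) \<Rightarrow> real" where
  "I f = (\<Sum>\<^sub>\<infinity>x. f x * \<psi> x * \<mu> x)"

definition T :: "('a \<Rightarrow> real) \<Rightarrow> 'a \<Rightarrow> real" where
  "T f x = (\<Sum>\<^sub>\<infinity>y. K x y * f y * \<mu> y)"

lemma L_bound:
  assumes "g \<in> L" "\<And>x. \<bar>f x\<bar> \<le> g x" shows "f \<in> L"
proof -
  have "(\<lambda>x. g x * \<psi> x * \<mu> x) summable_on UNIV" using assms(1) by (simp add: L_def)
  then show ?thesis unfolding L_def mem_Collect_eq
    by (rule summable_on_real_bound) 
      (use assms(2) psi_pos mu_pos in \<open>auto simp: abs_mult less_imp_le intro!: mult_right_mono\<close>)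
qed

lemma L_abs: "(\<lambda>x. \<bar>f x\<bar>) \<in> L \<longleftrightarrow> f \<in> L"
proof -
  have "(\<lambda>x. \<bar>f x\<bar> * \<psi> x * \<mu> x) = (\<lambda>x. \<bar>f x * \<psi> x * \<mu> x\<bar>)"
    using psi_pos mu_pos by (auto simp: abs_mult less_imp_le)
  then show ?thesis
    by (simp add: L_def summable_on_iff_abs_summable_on_real[where f = "\<lambda>x. f x * \<psi> x * \<mu> x"])
qed

lemma L_cmult: "f \<in> L \<Longrightarrow> (\<lambda>x. c * f x) \<in> L"
  using summable_on_cmult_right[of "\<lambda>x. f x * \<psi> x * \<mu> x" UNIV c] by (simp add: L_def mult.assoc)

lemma L_add: "f \<in> L \<Longrightarrow> g \<in> L \<Longrightarrow> (\<lambda>x. f x + g x) \<in> L"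
  using summable_on_add[of "\<lambda>x. f x * \<psi> x * \<mu> x" UNIV "\<lambda>x. g x * \<psi> x * \<mu> x"]
  by (simp add: L_def ring_distribs)

lemma L_diff: "f \<in> L \<Longrightarrow> g \<in> L \<Longrightarrow> (\<lambda>x. f x - g x) \<in> L"
  using L_add[of f "\<lambda>x. (- 1) * g x"] L_cmult[of g "- 1"] by simp

lemma L_restrict: "f \<in> L \<Longrightarrow> (\<lambda>x. indicator S x * f x) \<in> L"
  by (rule L_bound[of "\<lambda>x. \<bar>f x\<bar>"]) (auto simp: L_abs indicator_def)

lemma phi_L: "\<phi> \<in> L"
  using phi_psi_summable by (simp add: L_def)

text \<open>A single term of the eigenvalue equation for \<open>\<psi>\<close> is at most the whole
  sum. Each row of \<open>K\<close> is thus dominated by a multiple of \<open>\<psi>\<close>, which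
  is what makes \<open>T\<close> well defined on \<open>L\<close>.\<close>

lemma K_dom: "K x y \<le> lam / (\<psi> x * \<mu> x) * \<psi> y"
proof -
  have "K x y * \<psi> x * \<mu> x \<le> (\<Sum>\<^sub>\<infinity>x. K x y * \<psi> x * \<mu> x)"
    using psi_eigen[of y] K_pos psi_pos mu_pos
    by (intro le_infsum_nonneg[of "\<lambda>x. K x y * \<psi> x * \<mu> x"]) (auto simp: has_sum_iff less_imp_le)
  also have "\<dots> = lam * \<psi> y"
    using psi_eigen by (simp add: has_sum_iff)
  finally show ?thesis
    using psi_pos[of x] mu_pos[of x] by (simp add: field_simps)
qed

lemma T_summable:
  assumes "f \<in> L" shows "(\<lambda>y. K x y * f y * \<mu> y) summable_on UNIV"
proof -
  have "(\<lambda>y. lam / (\<psi> x * \<mu> x) * (\<bar>f y\<bar> * \<psi> y * \<mu> y)) summable_on UNIV"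
    using assms L_abs[of f] by (intro summable_on_cmult_right) (simp add: L_def)
  then show ?thesis
  proof (rule summable_on_real_bound)
    fix y
    have "K x y * (\<bar>f y\<bar> * \<mu> y) \<le> lam / (\<psi> x * \<mu> x) * \<psi> y * (\<bar>f y\<bar> * \<mu> y)"
      using K_dom mu_pos[of y] by (intro mult_right_mono) auto
    then show "\<bar>K x y * f y * \<mu> y\<bar> \<le> lam / (\<psi> x * \<mu> x) * (\<bar>f y\<bar> * \<psi> y * \<mu> y)"
      using K_pos[of x y] mu_pos[of y] by (simp add: abs_mult mult_ac)
  qed
qed

lemma T_cmult: "T (\<lambda>x. c * f x) = (\<lambda>x. c * T f x)"
proof
  fix x
  show "T (\<lambda>x. c * f x) x = c * T f x"
    unfolding T_def infsum_cmult_right'[symmetric] by (simp add: mult_ac)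
qed

lemma T_add:
  assumes "f \<in> L" "g \<in> L" shows "T (\<lambda>x. f x + g x) = (\<lambda>x. T f x + T g x)"
proof
  fix x
  show "T (\<lambda>x. f x + g x) x = T f x + T g x"
    using infsum_add[OF T_summable[OF assms(1)] T_summable[OF assms(2)], of x]
    by (simp add: T_def ring_distribs)
qed

lemma T_diff: "f \<in> L \<Longrightarrow> g \<in> L \<Longrightarrow> T (\<lambda>x. f x - g x) = (\<lambda>x. T f x - T g x)"
  using T_add[of f "\<lambda>x. (- 1) * g x"] L_cmult[of g "- 1"] T_cmult[of "- 1" g] by simp

lemma T_mono: "f \<in> L \<Longrightarrow> g \<in> L \<Longrightarrow> (\<And>x. f x \<le> g x) \<Longrightarrow> T f x \<le> T g x"
  unfolding T_def using K_pos mu_pos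
  by (intro infsum_mono T_summable) (auto simp: less_imp_le intro!: mult_left_mono mult_right_mono)

lemma T_phi: "T \<phi> = (\<lambda>x. lam * \<phi> x)"
  using phi_eigen by (auto simp: T_def has_sum_iff fun_eq_iff)

text \<open>Summing over the starting point \<open>x\<close> first turns
  \<open>K x y * \<psi> x * \<mu> x\<close> into \<open>lam * \<psi> y\<close>; Fubini allows this
  order, and the same computation with absolute values justifies it.\<close>

lemma
  assumes "f \<in> L"
  shows T_L: "T f \<in> L" and I_T: "I (T f) = lam * I f"
proof -
  define h where "h y x = f y * \<mu> y * (K x y * \<psi> x * \<mu> x)" for y x
  have "(h y has_sum f y * \<mu> y * (lam * \<psi> y)) UNIV" for y
    unfolding h_def using psi_eigen by (rule has_sum_cmult_right)
  moreover have "f y * \<mu> y * (lam * \<psi> y) = lam * (f y * \<psi> y * \<mu> y)" for y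
    by simp
  ultimately have h: "(h y has_sum lam * (f y * \<psi> y * \<mu> y)) UNIV" for y
    by simp
  have "\<bar>h y x\<bar> = \<bar>f y\<bar> * \<mu> y * (K x y * \<psi> x * \<mu> x)" for x y
    using K_pos mu_pos psi_pos by (simp add: h_def abs_mult less_imp_le)
  moreover have "((\<lambda>x. \<bar>f y\<bar> * \<mu> y * (K x y * \<psi> x * \<mu> x)) has_sum \<bar>f y\<bar> * \<mu> y * (lam * \<psi> y)) UNIV" for y
    using psi_eigen by (rule has_sum_cmult_right)
  moreover have "\<bar>f y\<bar> * \<mu> y * (lam * \<psi> y) = lam * (\<bar>f y\<bar> * \<psi> y * \<mu> y)" for y
    by simp
  ultimately have habs: "((\<lambda>x. \<bar>h y x\<bar>) has_sum lam * (\<bar>f y\<bar> * \<psi> y * \<mu> y)) UNIV" for y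
    by simp
  have 1: "h y summable_on UNIV" for y using h by (auto simp: has_sum_iff)
  have 2: "(\<lambda>y. \<Sum>\<^sub>\<infinity>x. \<bar>h y x\<bar>) summable_on UNIV"
    using habs assms L_abs[of f] by (simp add: has_sum_iff L_def summable_on_cmult_right)
  have T: "(\<Sum>\<^sub>\<infinity>y. h y x) = T f x * \<psi> x * \<mu> x" for x
    unfolding h_def T_def infsum_cmult_left'[symmetric] by (simp add: mult_ac)
  show "T f \<in> L"
    using fubini_real(2)[of h, OF 1 2] by (simp add: T L_def)
  have "lam * I f = (\<Sum>\<^sub>\<infinity>y. \<Sum>\<^sub>\<infinity>x. h y x)"
    using h by (simp add: I_def has_sum_iff infsum_cmult_right')
  also have "\<dots> = I (T f)"
    using fubini_real(1)[of h, OF 1 2] by (simp add: T I_def)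
  finally show "I (T f) = lam * I f" ..
qed

lemma Tn_L: "f \<in> L \<Longrightarrow> (T ^^ n) f \<in> L"
  by (induction n) (auto intro: T_L)

lemma I_Tn: "f \<in> L \<Longrightarrow> I ((T ^^ n) f) = lam ^ n * I f"
  by (induction n) (auto simp: I_T Tn_L)

lemma Tn_cmult: "(T ^^ n) (\<lambda>x. c * f x) = (\<lambda>x. c * (T ^^ n) f x)"
  by (induction n) (auto simp: T_cmult)

lemma Tn_mono: "f \<in> L \<Longrightarrow> g \<in> L \<Longrightarrow> (\<And>x. f x \<le> g x) \<Longrightarrow> (T ^^ n) f x \<le> (T ^^ n) g x"
  by (induction n arbitrary: x) (auto intro!: T_mono Tn_L)

lemma Tn_phi: "(T ^^ n) \<phi> = (\<lambda>x. lam ^ n * \<phi> x)"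
  by (induction n) (auto simp: T_phi T_cmult)

lemma zero_L: "(\<lambda>x. 0) \<in> L"
  by (simp add: L_def)

lemma Tn_nonneg: "f \<in> L \<Longrightarrow> (\<And>x. 0 \<le> f x) \<Longrightarrow> 0 \<le> (T ^^ n) f x"
  using Tn_mono[OF zero_L, of f n x] Tn_cmult[of n 0 f] by simp

section \<open>Kernels of the powers\<close>

text \<open>The density with respect to \<open>\<mu>\<close> of the unit mass at
  \<open>y\<close>.\<close>

definition pt :: "'a \<Rightarrow> 'a \<Rightarrow> real" where
  "pt y x = (if x = y then 1 / \<mu> y else 0)"

text \<open>The kernel is defined through its columns, so that semigroup facts about
  \<open>T\<close> apply to it directly. The recursion from the right, as in
  \<open>fk_kernel\<close>, is recovered in \<open>ker_Suc'\<close>.\<close>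

definition ker :: "nat \<Rightarrow> 'a \<Rightarrow> 'a \<Rightarrow> real" where
  "ker n x y = (T ^^ n) (pt y) x"

lemma pt_L: "pt y \<in> L"
  unfolding L_def by (auto simp: pt_def intro!: infsum_single(1)[of y])

lemma I_pt: "I (pt y) = \<psi> y"
  unfolding I_def using mu_pos[of y] by (subst infsum_single(2)[of y]) (auto simp: pt_def)

lemma T_pt: "T (pt y) = (\<lambda>x. K x y)"
proof
  fix x show "T (pt y) x = K x y"
  unfolding T_def using mu_pos[of y] by (subst infsum_single(2)[of y]) (auto simp: pt_def)
qed

lemma ker_nonneg: "0 \<le> ker n x y"
  unfolding ker_def using mu_pos by (intro Tn_nonneg pt_L) (auto simp: pt_def less_imp_le)

lemma ker_Suc: "ker (Suc n) x y = (T ^^ n) (\<lambda>x. K x y) x"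
  by (simp add: ker_def funpow_Suc_right T_pt del: funpow.simps)

lemma ker_add: "ker (m + n) x y = (T ^^ m) (\<lambda>x. ker n x y) x"
  by (simp add: ker_def funpow_add)

lemma ker_L: "(\<lambda>x. ker n x y) \<in> L"
  using Tn_L[OF pt_L, of n y] by (simp add: ker_def[abs_def])

lemma I_ker: "I (\<lambda>x. ker n x y) = lam ^ n * \<psi> y"
  using I_Tn[OF pt_L, of n y] by (simp add: ker_def[abs_def] I_pt)

text \<open>Induction on the number of steps, splitting off the first one. The form with
  \<open>has_sum\<close> records convergence, so that such sums can be subtracted termwise
  later.\<close>

lemma Tn_has_sum_ker:
  assumes "f \<in> L"
  shows "((\<lambda>y. ker n x y * f y * \<mu> y) has_sum (T ^^ n) f x) UNIV"
  using assms
proof (induction n arbitrary: x f)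
  case 0
  show ?case
    using infsum_single[of x "\<lambda>y. ker 0 x y * f y * \<mu> y"] mu_pos[of x]
    by (auto simp: ker_def pt_def has_sum_iff)
next
  case (Suc n)
  define h where "h z y = K x z * (ker n z y * f y * \<mu> y) * \<mu> z" for z y
  have 1: "(h z has_sum K x z * (T ^^ n) f z * \<mu> z) UNIV" for z
    unfolding h_def using Suc.IH[OF Suc.prems] by (intro has_sum_cmult_left has_sum_cmult_right)
  \<comment> \<open>The induction hypothesis at the absolute value of \<open>f\<close> supplies the
    absolute summability for Fubini; hence \<open>f\<close> is generalized in the induction.\<close>
  have "((\<lambda>y. K x z * (ker n z y * \<bar>f y\<bar> * \<mu> y) * \<mu> z) has_sum K x z * (T ^^ n) (\<lambda>y. \<bar>f y\<bar>) z * \<mu> z) UNIV" for z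
    using Suc.IH[of "\<lambda>y. \<bar>f y\<bar>"] Suc.prems L_abs[of f]
    by (intro has_sum_cmult_left has_sum_cmult_right) auto
  then have 2: "((\<lambda>y. \<bar>h z y\<bar>) has_sum K x z * (T ^^ n) (\<lambda>y. \<bar>f y\<bar>) z * \<mu> z) UNIV" for z
    using K_pos mu_pos ker_nonneg by (simp add: h_def abs_mult less_imp_le)
  have 3: "(\<lambda>z. \<Sum>\<^sub>\<infinity>y. \<bar>h z y\<bar>) summable_on UNIV"
    using 2 T_summable[OF Tn_L[of "\<lambda>y. \<bar>f y\<bar>" n], of x] L_abs[of f] Suc.prems by (simp add: has_sum_iff)
  have k: "(\<Sum>\<^sub>\<infinity>z. h z y) = ker (Suc n) x y * f y * \<mu> y" for y
  proof -
    have "h z y = K x z * ker n z y * \<mu> z * (f y * \<mu> y)" for z by (simp add: h_def)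
    then show ?thesis
      by (simp add: infsum_cmult_left' ker_def T_def)
  qed
  have s: "h z summable_on UNIV" for z using 1 by (auto simp: has_sum_iff)
  have "(\<Sum>\<^sub>\<infinity>y. \<Sum>\<^sub>\<infinity>z. h z y) = (\<Sum>\<^sub>\<infinity>z. \<Sum>\<^sub>\<infinity>y. h z y)"
    using fubini_real(1)[of h, OF s 3] ..
  also have "\<dots> = (T ^^ Suc n) f x"
    using 1 by (simp add: has_sum_iff T_def)
  finally show ?case
    using fubini_real(2)[of h, OF s 3] by (simp add: has_sum_iff k)
qed

lemma K_L: "(\<lambda>x. K x y) \<in> L"
  using T_L[OF pt_L[of y]] by (simp add: T_pt)

lemma ker_Suc': "ker (Suc n) x y = (\<Sum>\<^sub>\<infinity>z. ker n x z * K z y * \<mu> z)"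
  using Tn_has_sum_ker[OF K_L] by (simp add: has_sum_iff ker_Suc)

text \<open>The last step of the transposed chain is the first step of the original one, so
  \<open>D.ker_Suc'\<close> matches the unfolding of \<open>T\<close> from the left.\<close>

lemma dual_ker: "eigen_kernel.ker (\<lambda>x y. K y x) \<mu> n x y = ker n y x"
proof -
  interpret D: eigen_kernel "\<lambda>x y. K y x" \<mu> W C M lam \<psi> \<phi> by (rule dual)
  show ?thesis
  proof (induction n arbitrary: x y)
    case 0
    show ?case by (simp add: D.ker_def ker_def pt_def D.pt_def)
  next
    case (Suc n)
    show ?case
      unfolding D.ker_Suc' Suc by (simp add: ker_def T_def mult_ac)
  qed
qed

section \<open>Consequences of the two-step bound\<close>

lemma two_step_point: "K x w * K w y * \<mu> w \<le> C * W w * K x y"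
  using two_step[of "{w}" "W w" x y] W_pos[of w] by (simp add: less_imp_le)

text \<open>After Fubini the intermediate point \<open>w\<close> is summed first, and for each end
  point \<open>y\<close> the inner sum is the left side of \<open>two_step\<close>.\<close>

lemma T_restrict_T_le:
  assumes "f \<in> L" "\<And>y. 0 \<le> f y" "\<And>w. w \<in> S \<Longrightarrow> W w \<le> s" "0 \<le> s"
  shows "T (\<lambda>w. indicator S w * T f w) x \<le> C * s * T f x"
proof -
  define h where "h w y = indicator S w * (K x w * K w y * \<mu> w) * (f y * \<mu> y)" for w y
  have h0: "0 \<le> h w y" for w y
    unfolding h_def using K_pos mu_pos assms(2) by (intro mult_nonneg_nonneg) (auto simp: less_imp_le)
  have hs: "(h w has_sum K x w * (indicator S w * T f w) * \<mu> w) UNIV" for w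
  proof -
    have "((\<lambda>y. K w y * f y * \<mu> y) has_sum T f w) UNIV"
      using T_summable[OF assms(1)] by (simp add: has_sum_iff T_def)
    from has_sum_cmult_right[OF this, of "indicator S w * K x w * \<mu> w"]
    show ?thesis by (simp add: h_def[abs_def] mult_ac)
  qed
  have 1: "h w summable_on UNIV" for w using hs by (auto simp: has_sum_iff)
  have 2: "(\<lambda>w. \<Sum>\<^sub>\<infinity>y. \<bar>h w y\<bar>) summable_on UNIV"
    using hs T_summable[OF L_restrict[OF T_L[OF assms(1)]]] h0 by (simp add: has_sum_iff)
  have h2: "(\<Sum>\<^sub>\<infinity>w. h w y) \<le> C * s * (K x y * f y * \<mu> y)" for y
  proof -
    have "(\<Sum>\<^sub>\<infinity>w. h w y) = (\<Sum>\<^sub>\<infinity>w. indicator S w * (K x w * K w y * \<mu> w)) * (f y * \<mu> y)"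
      unfolding h_def by (rule infsum_cmult_left')
    also have "(\<Sum>\<^sub>\<infinity>w. indicator S w * (K x w * K w y * \<mu> w)) = (\<Sum>\<^sub>\<infinity>w\<in>S. K x w * K w y * \<mu> w)"
      by (rule infsum_cong_neutral) auto
    also have "\<dots> * (f y * \<mu> y) \<le> C * s * K x y * (f y * \<mu> y)"
      using two_step[of S s x y] assms mu_pos[of y] by (intro mult_right_mono) auto
    finally show ?thesis by (simp add: mult_ac)
  qed
  have "T (\<lambda>w. indicator S w * T f w) x = (\<Sum>\<^sub>\<infinity>w. \<Sum>\<^sub>\<infinity>y. h w y)"
    using hs by (simp add: has_sum_iff T_def)
  also have "\<dots> = (\<Sum>\<^sub>\<infinity>y. \<Sum>\<^sub>\<infinity>w. h w y)"
    using fubini_real(1)[of h, OF 1 2] .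
  also have "\<dots> \<le> (\<Sum>\<^sub>\<infinity>y. C * s * (K x y * f y * \<mu> y))"
    using fubini_real(2)[of h, OF 1 2] T_summable[OF assms(1)] h2
    by (intro infsum_mono summable_on_cmult_right) auto
  also have "\<dots> = C * s * T f x"
    by (simp add: T_def infsum_cmult_right')
  finally show ?thesis .
qed

text \<open>Replacing \<open>\<phi>\<close> by \<open>T \<phi> / lam\<close> makes the restricted
  step a two-step passage through \<open>S\<close>; the factor \<open>lam\<close> then
  cancels.\<close>

lemma T_restrict_phi_le:
  assumes "\<And>w. w \<in> S \<Longrightarrow> W w \<le> s" "0 \<le> s"
  shows "T (\<lambda>w. indicator S w * \<phi> w) x \<le> C * s * \<phi> x"
proof -
  have "lam * T (\<lambda>w. indicator S w * \<phi> w) x = T (\<lambda>w. indicator S w * T \<phi> w) x"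
    unfolding T_phi using fun_cong[OF T_cmult[of lam "\<lambda>w. indicator S w * \<phi> w"], of x]
    by (simp add: mult_ac)
  also have "\<dots> \<le> C * s * T \<phi> x"
    using assms phi_pos by (intro T_restrict_T_le phi_L) (auto simp: less_imp_le)
  also have "\<dots> = lam * (C * s * \<phi> x)" by (simp add: T_phi)
  finally show ?thesis using lam_pos by simp
qed

text \<open>The step out of \<open>S\<close> is merged with the one before it, and the remaining
  \<open>m - 1\<close> steps preserve the inequality. A preceding step exists because
  \<open>0 < m\<close>.\<close>

lemma Tn_restrict_K_le:
  assumes "\<And>w. w \<in> S \<Longrightarrow> W w \<le> s" "0 \<le> s" "0 < m"
  shows "(T ^^ m) (\<lambda>w. indicator S w * K w y) x \<le> C * s * ker m x y"
proof -
  obtain m' where m: "m = Suc m'" using assms(3) gr0_conv_Suc by blast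
  have "T (\<lambda>w. indicator S w * K w y) z \<le> C * s * K z y" for z
    using T_restrict_T_le[OF pt_L[of y], of S s z] assms mu_pos[of y] by (simp add: T_pt pt_def less_imp_le)
  then have "(T ^^ m') (T (\<lambda>w. indicator S w * K w y)) x \<le> (T ^^ m') (\<lambda>z. C * s * K z y) x"
    by (intro Tn_mono T_L L_restrict K_L L_cmult)
  then show ?thesis
    unfolding Tn_cmult by (simp add: m ker_Suc funpow_Suc_right del: funpow.simps)
qed

text \<open>Off the finite set \<open>F\<close> the two-step bound makes the restricted kernel a strict contraction
  of \<open>\<phi>\<close>, so half of \<open>T \<phi>\<close> comes from \<open>F\<close>; its one-point form then moves every point of \<open>F\<close>
  to \<open>y\<close>.\<close>

lemma column_minorization: "\<exists>c>0. \<forall>x. c * \<phi> x \<le> K x y"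
proof -
  \<comment> \<open>The threshold gives \<open>C * s = lam / 2\<close>. Below, \<open>D + 1\<close>
    in place of \<open>D\<close> keeps the constant finite and positive even if \<open>F\<close>
    should be empty.\<close>
  define s where "s = lam / (2 * C)"
  define F where "F = {x. s \<le> W x}"
  define D where "D = (\<Sum>w\<in>F. C * W w * \<phi> w / K w y)"
  have s: "0 < s" using lam_pos C_pos by (simp add: s_def)
  have F: "finite F" unfolding F_def using s by (rule finite_W)
  have D: "0 \<le> D"
    unfolding D_def using C_pos W_pos phi_pos K_pos by (intro sum_nonneg) (simp add: less_imp_le)
  have "lam / (2 * (D + 1)) * \<phi> x \<le> K x y" for x
  proof -
    have split: "(\<lambda>w. indicator (- F) w * \<phi> w + indicator F w * \<phi> w) = \<phi>"
      by (auto simp: indicator_def)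
    have "lam * \<phi> x = T (\<lambda>w. indicator (- F) w * \<phi> w + indicator F w * \<phi> w) x"
      unfolding split T_phi ..
    also have "\<dots> = T (\<lambda>w. indicator (- F) w * \<phi> w) x + T (\<lambda>w. indicator F w * \<phi> w) x"
      by (simp add: T_add L_restrict phi_L)
    also have "T (\<lambda>w. indicator (- F) w * \<phi> w) x \<le> C * s * \<phi> x"
      by (rule T_restrict_phi_le) (use s in \<open>auto simp: F_def\<close>)
    also have "C * s = lam / 2" using C_pos by (simp add: s_def)
    also have "T (\<lambda>w. indicator F w * \<phi> w) x = (\<Sum>\<^sub>\<infinity>w\<in>F. K x w * \<phi> w * \<mu> w)"
      unfolding T_def by (rule infsum_cong_neutral) auto
    also have "\<dots> = (\<Sum>w\<in>F. K x w * \<phi> w * \<mu> w)"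
      using F by simp
    also have "\<dots> \<le> (\<Sum>w\<in>F. K x y * (C * W w * \<phi> w / K w y))"
    proof (rule sum_mono)
      fix w
      have "(K x w * K w y * \<mu> w) * (\<phi> w / K w y) \<le> (C * W w * K x y) * (\<phi> w / K w y)"
        using two_step_point phi_pos[of w] K_pos[of w y] by (intro mult_right_mono) auto
      then show "K x w * \<phi> w * \<mu> w \<le> K x y * (C * W w * \<phi> w / K w y)"
        using K_pos[of w y] by (simp add: field_simps)
    qed
    also have "\<dots> = K x y * D" by (simp add: D_def sum_distrib_left)
    also have "\<dots> \<le> K x y * (D + 1)" using K_pos[of x y] by simp
    finally have "lam / 2 * \<phi> x \<le> K x y * (D + 1)" by (simp add: algebra_simps)
    then show ?thesis using D by (simp add: field_simps)
  qed
  moreover have "0 < lam / (2 * (D + 1))" using lam_pos D by simp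
  ultimately show ?thesis by blast
qed

text \<open>The minorization is read backwards: a multiple of \<open>\<phi>\<close> lies below a
  column of \<open>K\<close>, hence below \<open>M\<close>. In \<open>phi_mu_summable\<close> it
  inherits the summability of that column in the same way.\<close>

lemma phi_bounded: "\<exists>B>0. \<forall>x. \<phi> x \<le> B"
proof -
  fix y
  obtain c where c: "0 < c" "\<And>x. c * \<phi> x \<le> K x y" using column_minorization by blast
  have "\<phi> x \<le> M / c" for x
    using c(2)[of x] K_le[of x y] c(1) by (simp add: field_simps)
  then show ?thesis by (meson less_le_trans phi_pos)
qed

lemma phi_mu_summable: "(\<lambda>x. \<phi> x * \<mu> x) summable_on UNIV"
proof -
  fix y
  obtain c where c: "0 < c" "\<And>x. c * \<phi> x \<le> K x y" using column_minorization by blast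
  have "(\<lambda>x. 1 / c * (K x y * \<mu> x)) summable_on UNIV"
    by (intro summable_on_cmult_right col_summable)
  then show ?thesis
    by (rule summable_on_real_bound)
      (use c phi_pos mu_pos in \<open>auto simp: abs_mult less_imp_le field_simps\<close>)
qed

text \<open>Dually, \<open>\<psi> * \<mu>\<close> has finite mass. This admits the constant 1 to
  \<open>L\<close>, as needed for the normalized semigroup.\<close>

lemma one_L: "(\<lambda>_. 1) \<in> L"
  using eigen_kernel.phi_mu_summable[OF dual] by (simp add: L_def)

lemma I_phi_pos: "0 < I \<phi>"
proof -
  fix x
  have "0 < \<phi> x * \<psi> x * \<mu> x" using phi_pos psi_pos mu_pos by simp
  also have "\<dots> \<le> I \<phi>"
    unfolding I_def using phi_psi_summable phi_pos psi_pos mu_pos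
    by (intro le_infsum_nonneg) (auto simp: less_imp_le)
  finally show ?thesis .
qed

section \<open>Geometric contraction of the oscillation\<close>

lemma I_cmult: "I (\<lambda>x. c * f x) = c * I f"
  by (simp add: I_def infsum_cmult_right' mult.assoc)

lemma I_mono: "f \<in> L \<Longrightarrow> g \<in> L \<Longrightarrow> (\<And>x. f x \<le> g x) \<Longrightarrow> I f \<le> I g"
  unfolding I_def L_def using psi_pos mu_pos
  by (intro infsum_mono) (auto simp: less_imp_le intro!: mult_right_mono)

text \<open>A division-free way to confine \<open>f / \<phi>\<close> to the interval from
  \<open>a\<close> to \<open>b\<close>, whose width bounds the oscillation.\<close>

definition between :: "real \<Rightarrow> real \<Rightarrow> ('a \<Rightarrow> real) \<Rightarrow> bool" where
  "between a b f \<longleftrightarrow> f \<in> L \<and> (\<forall>x. a * \<phi> x \<le> f x \<and> f x \<le> b * \<phi> x)"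

text \<open>For \<open>g\<close> nonnegative, the single term at \<open>y\<close> of
  \<open>T g\<close> already exceeds a fixed multiple of \<open>g y * \<phi>\<close>, by the
  minorization. Applied to \<open>f - a * \<phi>\<close> and \<open>b * \<phi> - f\<close>, this
  raises the lower bound and lowers the upper one.\<close>

lemma contraction:
  "\<exists>\<rho>. 0 < \<rho> \<and> \<rho> < 1 \<and>
    (\<forall>a b f. between a b f \<longrightarrow> (\<exists>a' b'. b' - a' = \<rho> * (b - a) \<and> between (lam * a') (lam * b') (T f)))"
proof -
  fix y :: 'a
  obtain c where c: "0 < c" "\<And>x. c * \<phi> x \<le> K x y" using column_minorization by blast
  \<comment> \<open>The cap 1/2 keeps the contraction factor \<open>1 - e\<close> strictly
    positive.\<close>
  define e where "e = min (1 / 2) (c * \<phi> y * \<mu> y / lam)"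
  have e: "0 < e" "e < 1" "lam * e \<le> c * \<phi> y * \<mu> y"
    using c(1) phi_pos[of y] mu_pos[of y] lam_pos by (auto simp: e_def min_def field_simps)
  have low: "lam * (e * (g y / \<phi> y)) * \<phi> x \<le> T g x" if g: "g \<in> L" "\<And>z. 0 \<le> g z" for g x
  proof -
    have "lam * (e * (g y / \<phi> y)) * \<phi> x = lam * e * (g y / \<phi> y * \<phi> x)" by simp
    also have "\<dots> \<le> c * \<phi> y * \<mu> y * (g y / \<phi> y * \<phi> x)"
      using e(3) g(2)[of y] phi_pos[of x] phi_pos[of y]
      by (intro mult_right_mono mult_nonneg_nonneg) (auto simp: less_imp_le)
    also have "\<dots> = c * \<phi> x * (g y * \<mu> y)" using phi_pos[of y] by simp
    also have "\<dots> \<le> K x y * (g y * \<mu> y)"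
      using c(2) g(2)[of y] mu_pos[of y] by (intro mult_right_mono) auto
    also have "\<dots> \<le> T g x"
      unfolding T_def using le_infsum_nonneg[OF T_summable[OF g(1), of x], of y] g(2) K_pos mu_pos
      by (simp add: less_imp_le mult_ac)
    finally show ?thesis .
  qed
  have "\<exists>a' b'. b' - a' = (1 - e) * (b - a) \<and> between (lam * a') (lam * b') (T f)"
    if f: "between a b f" for a b f
  proof -
    \<comment> \<open>The gains \<open>e * (t - a)\<close> and \<open>e * (b - t)\<close> add up to
      \<open>e * (b - a)\<close> whatever the value \<open>t\<close> at the reference point.\<close>
    define t where "t = f y / \<phi> y"
    have fL: "f \<in> L" and fab: "\<And>x. a * \<phi> x \<le> f x" "\<And>x. f x \<le> b * \<phi> x"
      using f by (auto simp: between_def)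
    have cphi: "(\<lambda>x. r * \<phi> x) \<in> L" for r by (intro L_cmult phi_L)
    have T1: "T (\<lambda>x. f x - a * \<phi> x) x = T f x - lam * a * \<phi> x"
         and T2: "T (\<lambda>x. b * \<phi> x - f x) x = lam * b * \<phi> x - T f x" for x
      using T_diff[OF fL cphi] T_diff[OF cphi fL] by (simp_all add: T_cmult T_phi)
    have u1: "lam * (e * (t - a)) * \<phi> x \<le> T f x - lam * a * \<phi> x" for x
      using low[of "\<lambda>x. f x - a * \<phi> x" x] L_diff[OF fL cphi] fab phi_pos[of y] T1[of x]
      by (simp add: t_def diff_divide_distrib)
    have u2: "lam * (e * (b - t)) * \<phi> x \<le> lam * b * \<phi> x - T f x" for x
      using low[of "\<lambda>x. b * \<phi> x - f x" x] L_diff[OF cphi fL] fab phi_pos[of y] T2[of x]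
      by (simp add: t_def diff_divide_distrib)
    have "between (lam * (a + e * (t - a))) (lam * (b - e * (b - t))) (T f)"
      using u1 u2 fL by (auto simp: between_def T_L algebra_simps)
    then show ?thesis
      by (intro exI[of _ "a + e * (t - a)"] exI[of _ "b - e * (b - t)"]) (simp add: algebra_simps)
  qed
  then show ?thesis using e by (intro exI[of _ "1 - e"]) auto
qed

text \<open>After \<open>n\<close> steps \<open>(T ^^ n) f / (lam ^ n * \<phi>)\<close> lies in an
  interval of length \<open>\<rho> ^ n * b\<close>. Integrating its bounds with \<open>I\<close>
  shows that the interval also contains \<open>I f / I \<phi>\<close>, so the two differ by at most
  its length.\<close>

lemma mixing:
  "\<exists>\<rho>. 0 < \<rho> \<and> \<rho> < 1 \<and> (\<forall>b f n x. between 0 b f \<longrightarrow>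
     \<bar>(T ^^ n) f x - lam ^ n * \<phi> x * (I f / I \<phi>)\<bar> \<le> \<rho> ^ n * b * (lam ^ n * \<phi> x))"
proof -
  obtain \<rho> where r: "0 < \<rho>" "\<rho> < 1" and
    step: "\<And>a b f. between a b f \<Longrightarrow> \<exists>a' b'. b' - a' = \<rho> * (b - a) \<and> between (lam * a') (lam * b') (T f)"
    using contraction by blast
  have "\<bar>(T ^^ n) f x - lam ^ n * \<phi> x * (I f / I \<phi>)\<bar> \<le> \<rho> ^ n * b * (lam ^ n * \<phi> x)"
    if f: "between 0 b f" for b f n x
  proof -
    have "\<exists>a' b'. b' - a' = \<rho> ^ n * b \<and> between (lam ^ n * a') (lam ^ n * b') ((T ^^ n) f)"
    proof (induction n)
      case 0
      then show ?case using f by (intro exI[of _ 0] exI[of _ b]) simp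
    next
      case (Suc n)
      then obtain a' b' where ab: "b' - a' = \<rho> ^ n * b" "between (lam ^ n * a') (lam ^ n * b') ((T ^^ n) f)"
        by blast
      from step[OF ab(2)] obtain a'' b'' where
        ab2: "b'' - a'' = \<rho> * (lam ^ n * b' - lam ^ n * a')" "between (lam * a'') (lam * b'') (T ((T ^^ n) f))"
        by blast
      have "(b'' - a'') / lam ^ n = \<rho> * (b' - a')"
        using lam_pos ab2(1) by (simp add: field_simps)
      then have "b'' / lam ^ n - a'' / lam ^ n = \<rho> ^ Suc n * b"
        by (simp add: ab(1) diff_divide_distrib)
      then show ?case using ab2(2) lam_pos
        by (intro exI[of _ "a'' / lam ^ n"] exI[of _ "b'' / lam ^ n"]) simp
    qed
    then obtain a' b' where ab: "b' - a' = \<rho> ^ n * b" "between (lam ^ n * a') (lam ^ n * b') ((T ^^ n) f)"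
      by blast
    have Tf: "(T ^^ n) f \<in> L" "\<And>x. lam ^ n * a' * \<phi> x \<le> (T ^^ n) f x" "\<And>x. (T ^^ n) f x \<le> lam ^ n * b' * \<phi> x"
      using ab(2) by (auto simp: between_def)
    have fL: "f \<in> L" using f by (simp add: between_def)
    have "lam ^ n * a' * I \<phi> \<le> lam ^ n * I f" "lam ^ n * I f \<le> lam ^ n * b' * I \<phi>"
      using I_mono[OF L_cmult[OF phi_L] Tf(1) Tf(2)] I_mono[OF Tf(1) L_cmult[OF phi_L] Tf(3)]
      by (simp_all add: I_cmult I_Tn[OF fL])
    then have m: "a' \<le> I f / I \<phi>" "I f / I \<phi> \<le> b'"
      using lam_pos I_phi_pos by (simp_all add: field_simps)
    have pos: "0 < lam ^ n * \<phi> x" using lam_pos phi_pos[of x] by simp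
    have "(T ^^ n) f x - lam ^ n * \<phi> x * (I f / I \<phi>) \<le> lam ^ n * \<phi> x * b' - lam ^ n * \<phi> x * a'"
         "lam ^ n * \<phi> x * a' - lam ^ n * \<phi> x * b' \<le> (T ^^ n) f x - lam ^ n * \<phi> x * (I f / I \<phi>)"
      using Tf(2)[of x] Tf(3)[of x] mult_left_mono[OF m(1) less_imp_le[OF pos]] mult_left_mono[OF m(2) less_imp_le[OF pos]]
      by (simp_all add: mult_ac)
    then have "\<bar>(T ^^ n) f x - lam ^ n * \<phi> x * (I f / I \<phi>)\<bar> \<le> lam ^ n * \<phi> x * (b' - a')"
      by (simp add: abs_le_iff right_diff_distrib)
    then show ?thesis by (simp add: ab(1) mult_ac)
  qed
  then show ?thesis using r by blast
qed

section \<open>Uniform estimate of the kernel and of the two distances\<close>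

text \<open>The core of (a), with \<open>S\<close> in the role of \<open>A j\<close> and
  \<open>s\<close> bounding \<open>W\<close> off \<open>S\<close>. The constants
  \<open>\<rho>\<close> and \<open>D\<close> are chosen before the set, times and points, hence are
  uniform in them.\<close>

lemma kernel_estimate:
  fixes c :: real
  assumes c: "0 < c"
  obtains \<rho> D where "0 < \<rho>" "\<rho> < 1" "0 < D"
    "\<And>S s k l j x y. \<lbrakk>\<And>w z. w \<in> S \<Longrightarrow> ker j z w \<le> c * lam ^ j * \<phi> z * \<psi> w;
       \<And>y. ker (k + l + j) x y \<le> c * lam ^ (k + l + j) * \<phi> x * \<psi> y;
       \<And>w. w \<notin> S \<Longrightarrow> W w \<le> s; 0 \<le> s; 0 < j\<rbrakk>
     \<Longrightarrow> \<bar>ker (Suc (k + l + j)) x y - lam ^ Suc (k + l + j) * \<phi> x * \<psi> y / I \<phi>\<bar>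
       \<le> D * (s + \<rho> ^ k) * (lam ^ Suc (k + l + j) * \<phi> x * \<psi> y)"
proof -
  interpret D: eigen_kernel "\<lambda>x y. K y x" \<mu> W C M lam \<psi> \<phi> by (rule dual)
  obtain \<rho> where r: "0 < \<rho>" "\<rho> < 1" and mix: "\<And>b f n x. between 0 b f \<Longrightarrow>
     \<bar>(T ^^ n) f x - lam ^ n * \<phi> x * (I f / I \<phi>)\<bar> \<le> \<rho> ^ n * b * (lam ^ n * \<phi> x)"
    using mixing by blast
    \<comment> \<open>The first summand is the coefficient of \<open>\<rho> ^ k\<close>, the second
      that of \<open>s\<close> in the final bound.\<close>
    define D where "D = c + (C * c + C / I \<phi>) / lam"
    have D: "0 < D" using c C_pos I_phi_pos lam_pos by (simp add: D_def add_pos_pos)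
    have main: "\<bar>ker (Suc (k + l + j)) x y - lam ^ Suc (k + l + j) * \<phi> x * \<psi> y / I \<phi>\<bar>
       \<le> D * (s + \<rho> ^ k) * (lam ^ Suc (k + l + j) * \<phi> x * \<psi> y)"
      if col: "\<And>w z. w \<in> S \<Longrightarrow> ker j z w \<le> c * lam ^ j * \<phi> z * \<psi> w"
        and row: "\<And>y. ker (k + l + j) x y \<le> c * lam ^ (k + l + j) * \<phi> x * \<psi> y"
        and s: "\<And>w. w \<notin> S \<Longrightarrow> W w \<le> s" "0 \<le> s" and j: "0 < j"
      for S s k l j x y
    proof -
      define m where "m = k + l + j"
      define E where "E = lam ^ m * \<phi> x"
      have E: "0 < E" using lam_pos phi_pos by (simp add: E_def)
      define R where "R w = ker m x w - E * \<psi> w / I \<phi>" for w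
      have R: "\<bar>R w\<bar> \<le> c * \<rho> ^ k * E * \<psi> w" if w: "w \<in> S" for w
      proof -
        have "between 0 (c * lam ^ j * \<psi> w) (\<lambda>z. ker j z w)"
          using col[OF w] ker_nonneg by (auto simp: between_def ker_L mult_ac)
        from mix[OF this, of "k + l" x]
        have "\<bar>ker m x w - lam ^ (k + l) * \<phi> x * (lam ^ j * \<psi> w / I \<phi>)\<bar>
            \<le> \<rho> ^ (k + l) * (c * lam ^ j * \<psi> w) * (lam ^ (k + l) * \<phi> x)"
          by (simp add: m_def ker_add I_ker)
        \<comment> \<open>Contraction is available over \<open>k + l\<close> steps; only the factor
          from \<open>k\<close> of them is kept.\<close>
        also have "\<dots> \<le> \<rho> ^ k * (c * lam ^ j * \<psi> w) * (lam ^ (k + l) * \<phi> x)"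
          using r c lam_pos phi_pos[of x] psi_pos[of w]
          by (intro mult_right_mono power_decreasing) (auto simp: less_imp_le)
        finally show ?thesis by (simp add: R_def E_def m_def power_add mult_ac)
      qed
      have kerT: "((\<lambda>w. ker m x w * f w * \<mu> w) has_sum (T ^^ m) f x) UNIV" if "f \<in> L" for f
        using that by (rule Tn_has_sum_ker)
      \<comment> \<open>The part of the last step that leaves from outside \<open>S\<close>.\<close>
      define g where "g w = indicator (- S) w * K w y" for w
      have gL: "g \<in> L" unfolding g_def by (intro L_restrict K_L)
      have 1: "(T ^^ m) g x \<le> C * s * ker m x y"
        unfolding g_def by (rule Tn_restrict_K_le) (use s j in \<open>auto simp: m_def\<close>)
      \<comment> \<open>For the transposed kernel this is a step into the complement of
        \<open>S\<close> weighted by its eigenfunction \<open>\<psi>\<close>, so the dual of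
        \<open>T_restrict_phi_le\<close> applies.\<close>
      have "I g = D.T (\<lambda>w. indicator (- S) w * \<psi> w) y"
        by (simp add: I_def D.T_def g_def mult_ac)
      also have "\<dots> \<le> C * s * \<psi> y"
        by (rule D.T_restrict_phi_le) (use s in auto)
      finally have 2: "I g \<le> C * s * \<psi> y" .
      have g0: "0 \<le> g w" for w using K_pos[of w y] by (simp add: g_def indicator_def)
      have 3: "0 \<le> (T ^^ m) g x" using gL g0 by (rule Tn_nonneg)
      have 4: "0 \<le> I g" using I_mono[OF zero_L gL] g0 by (simp add: I_def)
      define q where "q w = R w * (indicator S w * K w y) * \<mu> w" for w
      have psi: "((\<lambda>w. \<psi> w * K w y * \<mu> w) has_sum lam * \<psi> y) UNIV"
        using psi_eigen by (simp add: mult_ac)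
      have "((\<lambda>w. c * \<rho> ^ k * E * (\<psi> w * K w y * \<mu> w)) has_sum c * \<rho> ^ k * E * (lam * \<psi> y)) UNIV"
        using psi by (rule has_sum_cmult_right)
      moreover have qle: "\<bar>q w\<bar> \<le> c * \<rho> ^ k * E * (\<psi> w * K w y * \<mu> w)" for w
      proof (cases "w \<in> S")
        case True
        have "\<bar>R w\<bar> * (K w y * \<mu> w) \<le> c * \<rho> ^ k * E * \<psi> w * (K w y * \<mu> w)"
          using R[OF True] K_pos[of w y] mu_pos[of w] by (intro mult_right_mono) auto
        then show ?thesis using True K_pos[of w y] mu_pos[of w] by (simp add: q_def abs_mult mult_ac)
      next
        case False
        then show ?thesis using c r E psi_pos[of w] K_pos[of w y] mu_pos[of w] by (simp add: q_def)
      qed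
      \<comment> \<open>The sum of \<open>q\<close> is the full deviation at \<open>y\<close> less
        the contribution from outside \<open>S\<close>. The latter is a difference of two
        nonnegative terms, each of order \<open>s\<close>.\<close>
      moreover have "(q has_sum ker (Suc m) x y - E * (lam * \<psi> y) / I \<phi> - ((T ^^ m) g x - E * I g / I \<phi>)) UNIV"
      proof -
        have gI: "((\<lambda>w. g w * \<psi> w * \<mu> w) has_sum I g) UNIV"
          using gL by (simp add: has_sum_iff L_def I_def)
        have "((\<lambda>w. ker m x w * K w y * \<mu> w - E / I \<phi> * (\<psi> w * K w y * \<mu> w)
            - (ker m x w * g w * \<mu> w - E / I \<phi> * (g w * \<psi> w * \<mu> w))) has_sum
            (T ^^ m) (\<lambda>w. K w y) x - E / I \<phi> * (lam * \<psi> y) - ((T ^^ m) g x - E / I \<phi> * I g)) UNIV"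
          by (intro has_sum_real_diff has_sum_cmult_right kerT K_L gL psi gI)
        moreover have "(\<lambda>w. ker m x w * K w y * \<mu> w - E / I \<phi> * (\<psi> w * K w y * \<mu> w)
            - (ker m x w * g w * \<mu> w - E / I \<phi> * (g w * \<psi> w * \<mu> w))) = q"
          by (auto simp: fun_eq_iff q_def R_def g_def indicator_def algebra_simps)
        ultimately show ?thesis by (simp add: ker_Suc)
      qed
      ultimately have 5: "\<bar>ker (Suc m) x y - E * (lam * \<psi> y) / I \<phi> - ((T ^^ m) g x - E * I g / I \<phi>)\<bar>
          \<le> c * \<rho> ^ k * E * (lam * \<psi> y)"
        by (rule has_sum_abs_le)
      have 6: "(T ^^ m) g x \<le> C * s * (c * E * \<psi> y)"
      proof (rule order_trans[OF 1 mult_left_mono])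
        show "ker m x y \<le> c * E * \<psi> y" using row[of y] by (simp add: m_def E_def mult_ac)
      qed (use C_pos s(2) in simp)
      have 7: "E * I g / I \<phi> \<le> E * (C * s * \<psi> y) / I \<phi>"
        using 2 E I_phi_pos by (intro divide_right_mono mult_left_mono) auto
      have 8: "0 \<le> E * I g / I \<phi>" using 4 E I_phi_pos by simp
      have "\<bar>ker (Suc m) x y - E * (lam * \<psi> y) / I \<phi>\<bar>
          \<le> c * \<rho> ^ k * E * (lam * \<psi> y) + C * s * (c * E * \<psi> y) + E * (C * s * \<psi> y) / I \<phi>"
        using 3 5 6 7 8 by linarith
      also have "\<dots> = (c * \<rho> ^ k + (C * c + C / I \<phi>) / lam * s) * (lam * E * \<psi> y)"
        using lam_pos I_phi_pos by (simp add: field_simps)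
      also have "\<dots> \<le> D * (s + \<rho> ^ k) * (lam * E * \<psi> y)"
      proof (rule mult_right_mono)
        have "0 \<le> c * s" "0 \<le> (C * c + C / I \<phi>) / lam * \<rho> ^ k"
          using c s(2) C_pos I_phi_pos lam_pos r by simp_all
        then show "c * \<rho> ^ k + (C * c + C / I \<phi>) / lam * s \<le> D * (s + \<rho> ^ k)"
          by (simp add: D_def distrib_left distrib_right)
      qed (use lam_pos E psi_pos[of y] in simp)
      finally show ?thesis by (simp add: E_def m_def mult_ac)
    qed
  show ?thesis by (rule that[OF r D main])
qed

text \<open>The kernel error is measured in multiples of \<open>\<psi>\<close>, so integrating it
  against \<open>f\<close> produces the norm of \<open>f\<close> in \<open>L\<close>.\<close>

lemma Tn_deviation:
  assumes "f \<in> L" and "\<And>y. \<bar>ker n x y - E * \<psi> y / I \<phi>\<bar> \<le> e * \<psi> y"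
  shows "\<bar>(T ^^ n) f x - E * I f / I \<phi>\<bar> \<le> e * I (\<lambda>y. \<bar>f y\<bar>)"
proof -
  have If: "((\<lambda>y. f y * \<psi> y * \<mu> y) has_sum I f) UNIV"
    using assms(1) by (simp add: has_sum_iff L_def I_def)
  have "((\<lambda>y. e * (\<bar>f y\<bar> * \<psi> y * \<mu> y)) has_sum e * I (\<lambda>y. \<bar>f y\<bar>)) UNIV"
    using assms(1) L_abs[of f] by (intro has_sum_cmult_right) (simp add: has_sum_iff L_def I_def)
  moreover have "\<bar>ker n x y * f y * \<mu> y - E / I \<phi> * (f y * \<psi> y * \<mu> y)\<bar> \<le> e * (\<bar>f y\<bar> * \<psi> y * \<mu> y)" for y
  proof -
    have "ker n x y * f y * \<mu> y - E / I \<phi> * (f y * \<psi> y * \<mu> y) = (ker n x y - E * \<psi> y / I \<phi>) * (f y * \<mu> y)"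
      by (simp add: algebra_simps)
    then have "\<bar>ker n x y * f y * \<mu> y - E / I \<phi> * (f y * \<psi> y * \<mu> y)\<bar>
        = \<bar>ker n x y - E * \<psi> y / I \<phi>\<bar> * (\<bar>f y\<bar> * \<mu> y)"
      using mu_pos[of y] by (simp add: abs_mult)
    also have "\<dots> \<le> e * \<psi> y * (\<bar>f y\<bar> * \<mu> y)"
      using assms(2) mu_pos[of y] by (intro mult_right_mono) auto
    finally show ?thesis by (simp add: mult_ac)
  qed
  moreover have "((\<lambda>y. ker n x y * f y * \<mu> y - E / I \<phi> * (f y * \<psi> y * \<mu> y)) has_sum
      (T ^^ n) f x - E / I \<phi> * I f) UNIV"
    by (intro has_sum_real_diff has_sum_cmult_right Tn_has_sum_ker assms(1) If)
  ultimately have "\<bar>(T ^^ n) f x - E / I \<phi> * I f\<bar> \<le> e * I (\<lambda>y. \<bar>f y\<bar>)"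
    by (rule has_sum_abs_le)
  then show ?thesis by (simp add: mult_ac)
qed

text \<open>Multiplication by \<open>\<phi>\<close> maps the ball of l1(\<open>\<nu>\<close>) into
  the unit ball of \<open>L\<close> and turns the mean into \<open>I g / I \<phi>\<close>; dividing
  by \<open>lam ^ n * \<phi> x\<close> makes the error relative.\<close>

lemma intrinsic_bound:
  assumes dev: "\<And>y. \<bar>ker n x y - lam ^ n * \<phi> x * \<psi> y / I \<phi>\<bar> \<le> d * (lam ^ n * \<phi> x * \<psi> y)"
    and d: "0 \<le> d" and f: "f \<in> l1_ball (nu_meas \<mu> \<phi> \<psi>)"
  shows "\<bar>intrinsic T lam \<phi> n f x - mean (nu_meas \<mu> \<phi> \<psi>) f\<bar> \<le> d"
proof -
  define g where "g y = f y * \<phi> y" for y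
  define E where "E = lam ^ n * \<phi> x"
  have E: "0 < E" using lam_pos phi_pos by (simp add: E_def)
  have eq: "\<bar>f y\<bar> * nu_meas \<mu> \<phi> \<psi> y = \<bar>g y\<bar> * \<psi> y * \<mu> y" for y
    using phi_pos[of y] by (simp add: nu_meas_def g_def abs_mult)
  have gL: "g \<in> L" and g1: "I (\<lambda>y. \<bar>g y\<bar>) \<le> 1"
    using f L_abs[of g] by (auto simp: l1_ball_def l1_norm_def eq L_def I_def)
  have m: "mean (nu_meas \<mu> \<phi> \<psi>) f = I g / I \<phi>"
    by (simp add: mean_def nu_meas_def I_def g_def mult_ac)
  have "\<bar>ker n x y - E * \<psi> y / I \<phi>\<bar> \<le> d * E * \<psi> y" for y
    using dev[of y] by (simp add: E_def mult_ac)
  from Tn_deviation[OF gL this] have "\<bar>(T ^^ n) g x - E * I g / I \<phi>\<bar> \<le> d * E * I (\<lambda>y. \<bar>g y\<bar>)" .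
  also have "\<dots> \<le> d * E" using g1 d E by (simp add: mult_left_le)
  finally have "\<bar>(T ^^ n) g x - E * I g / I \<phi>\<bar> / E \<le> d" using E by (simp add: field_simps)
  moreover have "\<bar>(T ^^ n) g x - E * I g / I \<phi>\<bar> / E = \<bar>((T ^^ n) g x - E * I g / I \<phi>) / E\<bar>"
    using E by simp
  moreover have "((T ^^ n) g x - E * I g / I \<phi>) / E = intrinsic T lam \<phi> n f x - I g / I \<phi>"
    using lam_pos phi_pos[of x] by (simp add: intrinsic_def E_def g_def[abs_def] diff_divide_distrib)
  ultimately show ?thesis by (simp add: m)
qed

lemma l1_norm_psi: "l1_norm \<mu> \<psi> = I (\<lambda>_. 1)"
  using psi_pos by (simp add: l1_norm_def I_def less_imp_le)

lemma I_one_pos: "0 < I (\<lambda>_. 1)"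
proof -
  fix x
  have "0 < \<psi> x * \<mu> x" using psi_pos mu_pos by simp
  also have "\<dots> \<le> (\<Sum>\<^sub>\<infinity>x. \<psi> x * \<mu> x)"
    using one_L psi_pos mu_pos by (intro le_infsum_nonneg) (auto simp: L_def less_imp_le)
  finally show ?thesis by (simp add: I_def)
qed

lemma qs_ball_iff:
  "f \<in> l1_ball (qs_meas \<mu> \<psi>) \<longleftrightarrow> f \<in> L \<and> I (\<lambda>y. \<bar>f y\<bar>) \<le> I (\<lambda>_. 1)"
proof -
  have "(\<lambda>y. \<bar>f y\<bar> * qs_meas \<mu> \<psi> y) = (\<lambda>y. \<bar>f y\<bar> * \<psi> y * \<mu> y * (1 / I (\<lambda>_. 1)))"
    by (simp add: qs_meas_def l1_norm_psi mult.assoc)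
  then show ?thesis
    using I_one_pos L_abs[of f] summable_on_cmult_left'[of "1 / I (\<lambda>_. 1)" "\<lambda>y. \<bar>f y\<bar> * \<psi> y * \<mu> y" UNIV]
      infsum_cmult_left'[of "\<lambda>y. \<bar>f y\<bar> * \<psi> y * \<mu> y" "1 / I (\<lambda>_. 1)" UNIV]
    by (simp add: l1_ball_def l1_norm_def L_def I_def)
qed

lemma infsum_qs: "(\<Sum>\<^sub>\<infinity>y. f y * qs_meas \<mu> \<psi> y) = I f / I (\<lambda>_. 1)"
  using infsum_cmult_left'[of "\<lambda>y. f y * \<psi> y * \<mu> y" "1 / I (\<lambda>_. 1)" UNIV]
  unfolding qs_meas_def l1_norm_psi by (simp add: I_def mult_ac)

text \<open>Positivity of \<open>T\<close> is applied to \<open>\<phi> / B \<le> 1\<close>. The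
  bound controls the denominator of the normalized semigroup.\<close>

lemma Tn_one_ge:
  assumes "0 < B" "\<And>x. \<phi> x \<le> B"
  shows "lam ^ n * \<phi> x / B \<le> (T ^^ n) (\<lambda>_. 1) x"
proof -
  have "(T ^^ n) (\<lambda>x. 1 / B * \<phi> x) x \<le> (T ^^ n) (\<lambda>_. 1) x"
    using assms by (intro Tn_mono L_cmult phi_L one_L) (simp add: field_simps)
  then show ?thesis unfolding Tn_cmult Tn_phi by simp
qed

lemma Tn_one_pos: "0 < (T ^^ n) (\<lambda>_. 1) x"
proof -
  obtain B where B: "0 < B" "\<And>x. \<phi> x \<le> B" using phi_bounded by blast
  have "0 < lam ^ n * \<phi> x / B" using B(1) lam_pos phi_pos by simp
  then show ?thesis using Tn_one_ge[OF B, of n x] by linarith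
qed

text \<open>Numerator and denominator are each compared with their stationary values. The two errors
  give the factor 2, and division by \<open>(T ^^ n) 1 x\<close>, at least
  \<open>lam ^ n * \<phi> x / B\<close>, gives the factor \<open>B\<close>.\<close>

lemma qs_bound:
  assumes dev: "\<And>y. \<bar>ker n x y - lam ^ n * \<phi> x * \<psi> y / I \<phi>\<bar> \<le> d * (lam ^ n * \<phi> x * \<psi> y)"
    and d: "0 \<le> d" and B: "0 < B" "\<And>x. \<phi> x \<le> B" and f: "f \<in> l1_ball (qs_meas \<mu> \<psi>)"
  shows "\<bar>(T ^^ n) f x / (T ^^ n) (\<lambda>_. 1) x - (\<Sum>\<^sub>\<infinity>y. f y * qs_meas \<mu> \<psi> y)\<bar>
    \<le> 2 * I (\<lambda>_. 1) * B * d"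
proof -
  define Z where "Z = I (\<lambda>_. 1)"
  define E where "E = lam ^ n * \<phi> x"
  define a where "a = (T ^^ n) f x"
  define b where "b = (T ^^ n) (\<lambda>_. 1) x"
  have Z: "0 < Z" using I_one_pos by (simp add: Z_def)
  have E: "0 < E" using lam_pos phi_pos by (simp add: E_def)
  have b: "E / B \<le> b" using Tn_one_ge[OF B] by (simp add: E_def b_def)
  then have b0: "0 < b" using E B(1) by (smt (verit) divide_pos_pos)
  have fL: "f \<in> L" and f1: "I (\<lambda>y. \<bar>f y\<bar>) \<le> Z" using f by (auto simp: qs_ball_iff Z_def)
  have "I f \<le> I (\<lambda>y. \<bar>f y\<bar>)" using fL L_abs by (intro I_mono) auto
  moreover have "I (\<lambda>y. (- 1) * f y) \<le> I (\<lambda>y. \<bar>f y\<bar>)" using fL L_abs by (intro I_mono L_cmult) auto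
  ultimately have If: "\<bar>I f\<bar> \<le> Z" unfolding I_cmult using f1 by linarith
  have dev': "\<bar>ker n x y - E * \<psi> y / I \<phi>\<bar> \<le> d * E * \<psi> y" for y
    using dev[of y] by (simp add: E_def mult_ac)
  have "\<bar>a - E * I f / I \<phi>\<bar> \<le> d * E * I (\<lambda>y. \<bar>f y\<bar>)"
    unfolding a_def by (rule Tn_deviation[OF fL dev'])
  also have "\<dots> \<le> d * E * Z" using f1 d E by (intro mult_left_mono) auto
  finally have da: "\<bar>a - E * I f / I \<phi>\<bar> \<le> d * E * Z" .
  have db: "\<bar>b - E * Z / I \<phi>\<bar> \<le> d * E * Z"
    using Tn_deviation[OF one_L dev'] by (simp add: b_def Z_def)
  have If1: "\<bar>I f / Z\<bar> \<le> 1" using If Z by simp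
  \<comment> \<open>The stationary parts cancel, leaving only the two deviations.\<close>
  have "a - I f / Z * b = (a - E * I f / I \<phi>) - I f / Z * (b - E * Z / I \<phi>)"
    using Z by (simp add: field_simps)
  then have "\<bar>a - I f / Z * b\<bar> \<le> \<bar>a - E * I f / I \<phi>\<bar> + \<bar>I f / Z\<bar> * \<bar>b - E * Z / I \<phi>\<bar>"
    using abs_triangle_ineq4[of "a - E * I f / I \<phi>" "I f / Z * (b - E * Z / I \<phi>)"] by (simp only: abs_mult)
  moreover have "\<bar>I f / Z\<bar> * \<bar>b - E * Z / I \<phi>\<bar> \<le> 1 * (d * E * Z)"
    using If1 db by (rule mult_mono) simp_all
  ultimately have "\<bar>a - I f / Z * b\<bar> \<le> 2 * (d * E * Z)" using da by linarith
  also have "\<dots> = 2 * d * Z * E" by simp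
  also have "\<dots> \<le> 2 * d * Z * (B * b)"
    using b B(1) d Z by (intro mult_left_mono) (auto simp: field_simps)
  finally have "\<bar>a - I f / Z * b\<bar> / b \<le> 2 * Z * B * d" using b0 by (simp add: field_simps)
  moreover have "a / b - I f / Z = (a - I f / Z * b) / b"
    using b0 Z by (simp add: field_simps)
  then have "\<bar>a / b - I f / Z\<bar> = \<bar>a - I f / Z * b\<bar> / b"
    using b0 by (simp only: abs_divide abs_of_pos)
  ultimately have "\<bar>a / b - I f / Z\<bar> \<le> 2 * Z * B * d" by (simp only:)
  then show ?thesis by (simp only: infsum_qs a_def b_def Z_def)
qed

section \<open>Convergence from progressive ultracontractivity\<close>

lemma W_bounded: "\<exists>B. \<forall>x. W x \<le> B"
proof -
  have F: "finite {x. 1 \<le> W x}" by (rule finite_W) simp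
  have "W x \<le> Max (insert 1 (W ` {x. 1 \<le> W x}))" for x
    using F by (cases "1 \<le> W x") (auto intro: Max_ge simp: Max_ge_iff)
  then show ?thesis by blast
qed

theorem pIUC_convergence:
  assumes n0: "1 \<le> n0" and ex: "exhausting A"
    and pIUC: "pIUC_from ker lam \<phi> \<psi> A n0" "pIUC_from (\<lambda>n x y. ker n y x) lam \<psi> \<phi> A n0"
  shows "\<exists>C1>0. \<exists>C2>0. \<exists>\<rho>. 0 < \<rho> \<and> \<rho> < 1 \<and>
    (\<forall>n k l j. 2 * n0 + 1 < n \<and> n0 \<le> l \<and> n0 \<le> j \<and> k + l + j = n - 1 \<longrightarrow>
      intrinsic_dist T lam \<phi> (nu_meas \<mu> \<phi> \<psi>) n (A l)
        \<le> ennreal C1 * ((SUP z\<in>- A j. ennreal (W z)) + ennreal (\<rho> ^ k)) \<and>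
      qs_dist T (qs_meas \<mu> \<psi>) n (A l)
        \<le> ennreal C2 * ((SUP z\<in>- A j. ennreal (W z)) + ennreal (\<rho> ^ k)))"
proof -
  obtain c1 where c1: "0 < c1"
      "\<And>n x y. n0 \<le> n \<Longrightarrow> x \<in> A n \<Longrightarrow> ker n x y \<le> c1 * lam ^ n * \<phi> x * \<psi> y"
    using pIUC(1) by (auto simp: pIUC_from_def)
  obtain c2 where c2: "0 < c2"
      "\<And>n x y. n0 \<le> n \<Longrightarrow> x \<in> A n \<Longrightarrow> ker n y x \<le> c2 * lam ^ n * \<psi> x * \<phi> y"
    using pIUC(2) by (auto simp: pIUC_from_def)
  define c where "c = max c1 c2"
  have c: "0 < c" using c1(1) by (simp add: c_def)
  have pos: "0 \<le> lam ^ n * \<phi> x * \<psi> y" for n x y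
    using lam_pos phi_pos[of x] psi_pos[of y] by simp
  have row: "ker n x y \<le> c * lam ^ n * \<phi> x * \<psi> y" if "n0 \<le> n" "x \<in> A n" for n x y
    using c1(2)[OF that, of y] mult_right_mono[OF _ pos, of c1 c n x y] by (simp add: c_def mult_ac)
  have col: "ker n y x \<le> c * lam ^ n * \<phi> y * \<psi> x" if "n0 \<le> n" "x \<in> A n" for n x y
    using c2(2)[OF that, of y] mult_right_mono[OF _ pos, of c2 c n y x] by (simp add: c_def mult_ac)
  show ?thesis
  proof (rule kernel_estimate[OF c])
    fix \<rho> D :: real
    assume r: "0 < \<rho>" "\<rho> < 1" and D: "0 < D" and est:
      "\<And>S s k l j x y. \<lbrakk>\<And>w z. w \<in> S \<Longrightarrow> ker j z w \<le> c * lam ^ j * \<phi> z * \<psi> w;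
         \<And>y. ker (k + l + j) x y \<le> c * lam ^ (k + l + j) * \<phi> x * \<psi> y;
         \<And>w. w \<notin> S \<Longrightarrow> W w \<le> s; 0 \<le> s; 0 < j\<rbrakk>
       \<Longrightarrow> \<bar>ker (Suc (k + l + j)) x y - lam ^ Suc (k + l + j) * \<phi> x * \<psi> y / I \<phi>\<bar>
         \<le> D * (s + \<rho> ^ k) * (lam ^ Suc (k + l + j) * \<phi> x * \<psi> y)"
    obtain B where B: "0 < B" "\<And>x. \<phi> x \<le> B" using phi_bounded by blast
    define C2 where "C2 = 2 * I (\<lambda>_. 1) * B * D"
    have C2: "0 < C2" using I_one_pos B D by (simp add: C2_def)
    have step: "A n \<subseteq> A (Suc n)" if "1 \<le> n" for n
      using ex that by (simp add: exhausting_def)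
    have mono: "A m \<subseteq> A n" if "1 \<le> m" "m \<le> n" for m n
      using that(2)
    proof (induction rule: dec_induct)
      case (step i)
      then show ?case using \<open>\<And>n. 1 \<le> n \<Longrightarrow> A n \<subseteq> A (Suc n)\<close>[of i] that(1) by (meson le_trans subset_trans)
    qed simp
    have "intrinsic_dist T lam \<phi> (nu_meas \<mu> \<phi> \<psi>) n (A l)
          \<le> ennreal D * ((SUP z\<in>- A j. ennreal (W z)) + ennreal (\<rho> ^ k)) \<and>
        qs_dist T (qs_meas \<mu> \<psi>) n (A l)
          \<le> ennreal C2 * ((SUP z\<in>- A j. ennreal (W z)) + ennreal (\<rho> ^ k))"
      if n: "2 * n0 + 1 < n" "n0 \<le> l" "n0 \<le> j" "k + l + j = n - 1" for n k l j
    proof -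
      \<comment> \<open>Since \<open>W\<close> is bounded, the extended supremum is a real number;
        it is 0 when \<open>A j\<close> is everything.\<close>
      define s where "s = enn2real (SUP z\<in>- A j. ennreal (W z))"
      obtain M' where "\<And>x. W x \<le> M'" using W_bounded by blast
      then have "(SUP z\<in>- A j. ennreal (W z)) \<le> ennreal M'"
        by (intro SUP_least ennreal_leI)
      then have s: "(SUP z\<in>- A j. ennreal (W z)) = ennreal s"
        unfolding s_def by (metis ennreal_enn2real_if ennreal_neq_top top.extremum_unique)
      have s0: "0 \<le> s" by (simp add: s_def)
      have Ws: "W w \<le> s" if "w \<notin> A j" for w
        using SUP_upper[of w "- A j" "\<lambda>z. ennreal (W z)"] that s0 unfolding s by simp
      have dev: "\<bar>ker n x y - lam ^ n * \<phi> x * \<psi> y / I \<phi>\<bar> \<le> D * (s + \<rho> ^ k) * (lam ^ n * \<phi> x * \<psi> y)"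
        if "x \<in> A l" for x y
      proof -
        have n': "n = Suc (k + l + j)" using n by simp
        \<comment> \<open>The row bound is needed at time \<open>k + l + j\<close>, while
          \<open>x\<close> lies in \<open>A l\<close>. The exhaustion increases from index 1 on, and
          \<open>l\<close> is at least \<open>n0\<close>.\<close>
        have "x \<in> A (k + l + j)" using mono[of l "k + l + j"] n n0 that by auto
        then have 1: "ker (k + l + j) x y \<le> c * lam ^ (k + l + j) * \<phi> x * \<psi> y" for y
          using n(2) by (intro row) auto
        have 2: "ker j z w \<le> c * lam ^ j * \<phi> z * \<psi> w" if "w \<in> A j" for w z
          using n(3) that by (rule col)
        show ?thesis
          unfolding n' using n(3) n0 by (intro est[OF 2 1 Ws s0]) auto
      qed
      have d: "0 \<le> D * (s + \<rho> ^ k)" using D s0 r by simp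
      have sum: "(SUP z\<in>- A j. ennreal (W z)) + ennreal (\<rho> ^ k) = ennreal (s + \<rho> ^ k)"
        using s0 r by (simp add: s ennreal_plus)
      have "\<bar>intrinsic T lam \<phi> n f x - mean (nu_meas \<mu> \<phi> \<psi>) f\<bar> \<le> D * (s + \<rho> ^ k)"
        if "x \<in> A l" "f \<in> l1_ball (nu_meas \<mu> \<phi> \<psi>)" for x f
        using dev[OF that(1)] d that(2) by (rule intrinsic_bound)
      then have "intrinsic_dist T lam \<phi> (nu_meas \<mu> \<phi> \<psi>) n (A l) \<le> ennreal (D * (s + \<rho> ^ k))"
        unfolding intrinsic_dist_def by (intro SUP_least ennreal_leI)
      moreover have "\<bar>(T ^^ n) f x / (T ^^ n) (\<lambda>_. 1) x - (\<Sum>\<^sub>\<infinity>y. f y * qs_meas \<mu> \<psi> y)\<bar>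
          \<le> C2 * (s + \<rho> ^ k)"
        if "x \<in> A l" "f \<in> l1_ball (qs_meas \<mu> \<psi>)" for x f
        using qs_bound[OF dev[OF that(1)] d B that(2)] by (simp add: C2_def mult.assoc)
      then have "qs_dist T (qs_meas \<mu> \<psi>) n (A l) \<le> ennreal (C2 * (s + \<rho> ^ k))"
        unfolding qs_dist_def by (intro SUP_least ennreal_leI)
      ultimately show ?thesis
        unfolding sum using D C2 s0 r by (simp add: ennreal_mult)
    qed
    then show ?thesis using D C2 r by blast
  qed
qed

section \<open>Progressive ultracontractivity from convergence\<close>

text \<open>For the normalized point mass at \<open>y\<close>, the intrinsic semigroup returns
  \<open>ker n x y / (lam ^ n * \<phi> x * \<psi> y)\<close> and the mean is
  \<open>1 / I \<phi>\<close>. Distance below 1 therefore bounds this ratio by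
  \<open>1 + 1 / I \<phi>\<close>.\<close>

lemma intrinsic_dist_pIUC:
  assumes "(\<lambda>n. intrinsic_dist T lam \<phi> (nu_meas \<mu> \<phi> \<psi>) n (A n)) \<longlonglongrightarrow> 0"
  shows "\<exists>N. pIUC_from ker lam \<phi> \<psi> A N"
proof -
  have "\<forall>\<^sub>F n in sequentially. intrinsic_dist T lam \<phi> (nu_meas \<mu> \<phi> \<psi>) n (A n) < 1"
    using assms by (rule order_tendstoD) simp
  then obtain N where N: "\<And>n. N \<le> n \<Longrightarrow> intrinsic_dist T lam \<phi> (nu_meas \<mu> \<phi> \<psi>) n (A n) < 1"
    by (auto simp: eventually_sequentially)
  have "ker n x y \<le> (1 + 1 / I \<phi>) * lam ^ n * \<phi> x * \<psi> y" if n: "N \<le> n" and x: "x \<in> A n" for n x y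
  proof -
    define \<nu> where "\<nu> = nu_meas \<mu> \<phi> \<psi>"
    define f where "f z = (if z = y then 1 / \<nu> y else 0)" for z
    have nu: "0 < \<nu> y" using phi_pos psi_pos mu_pos by (simp add: \<nu>_def nu_meas_def)
    have f: "f \<in> l1_ball \<nu>"
      using infsum_single[of y "\<lambda>z. \<bar>f z\<bar> * \<nu> z"] nu by (simp add: l1_ball_def l1_norm_def f_def)
    have m: "mean \<nu> f = 1 / I \<phi>"
      using infsum_single[of y "\<lambda>z. f z * \<nu> z"] nu
      by (simp add: mean_def f_def) (simp add: \<nu>_def nu_meas_def[abs_def] I_def)
    have f\<phi>: "(\<lambda>z. f z * \<phi> z) = (\<lambda>z. 1 / \<psi> y * pt y z)"
      using phi_pos[of y] psi_pos[of y] mu_pos[of y] by (auto simp: f_def pt_def \<nu>_def nu_meas_def)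
    have i: "intrinsic T lam \<phi> n f x = ker n x y / (lam ^ n * \<phi> x * \<psi> y)"
      unfolding intrinsic_def f\<phi> Tn_cmult ker_def by simp
    have "ennreal \<bar>intrinsic T lam \<phi> n f x - mean \<nu> f\<bar> \<le> intrinsic_dist T lam \<phi> \<nu> n (A n)"
      unfolding intrinsic_dist_def using x f by (intro SUP_upper2[of x] SUP_upper2[of f]) auto
    also have "\<dots> < 1" using N[OF n] by (simp add: \<nu>_def)
    finally have "ker n x y / (lam ^ n * \<phi> x * \<psi> y) \<le> 1 + 1 / I \<phi>"
      by (simp add: i m)
    then show ?thesis
      using lam_pos phi_pos[of x] psi_pos[of y] by (simp add: pos_divide_le_eq mult_ac)
  qed
  then show ?thesis
    unfolding pIUC_from_def using I_phi_pos by (intro exI[of _ N] exI[of _ "1 + 1 / I \<phi>"]) (simp add: add_pos_pos)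
qed

text \<open>Testing with a point mass bounds the kernel by \<open>T\<^sup>n 1\<close>; testing with \<open>\<phi>\<close> bounds \<open>T\<^sup>n 1\<close>
  by \<open>\<lambda>\<^sup>n \<phi>\<close>.\<close>

lemma qs_dist_pIUC:
  assumes "(\<lambda>n. qs_dist T (qs_meas \<mu> \<psi>) n (A n)) \<longlonglongrightarrow> 0"
  shows "\<exists>N. pIUC_from ker lam \<phi> \<psi> A N"
proof -
  \<comment> \<open>Both test functions below are scaled to have mean 1. A distance below 1/2 thus
    bounds the quotient from above for the point mass and away from 0 for
    \<open>\<phi>\<close>.\<close>
  have "\<forall>\<^sub>F n in sequentially. qs_dist T (qs_meas \<mu> \<psi>) n (A n) < ennreal (1 / 2)"
    using assms by (rule order_tendstoD) (metis ennreal_less_zero_iff half_gt_zero_iff zero_less_one)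
  then obtain N where N: "\<And>n. N \<le> n \<Longrightarrow> qs_dist T (qs_meas \<mu> \<psi>) n (A n) < ennreal (1 / 2)"
    by (auto simp: eventually_sequentially)
  define Z where "Z = I (\<lambda>_. 1)"
  have Z: "0 < Z" using I_one_pos by (simp add: Z_def)
  have "ker n x y \<le> 4 / I \<phi> * lam ^ n * \<phi> x * \<psi> y" if n: "N \<le> n" and x: "x \<in> A n" for n x y
  proof -
    define b where "b = (T ^^ n) (\<lambda>_. 1) x"
    have b: "0 < b" using Tn_one_pos by (simp add: b_def)
    have close: "\<bar>(T ^^ n) f x / b - I f / Z\<bar> < 1 / 2" if "f \<in> l1_ball (qs_meas \<mu> \<psi>)" for f
    proof -
      have "ennreal \<bar>(T ^^ n) f x / b - I f / Z\<bar> \<le> qs_dist T (qs_meas \<mu> \<psi>) n (A n)"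
        unfolding qs_dist_def infsum_qs b_def Z_def using x that by (intro SUP_upper2[of x] SUP_upper2[of f]) auto
      also have "\<dots> < ennreal (1 / 2)" by (rule N[OF n])
      finally show ?thesis by (simp only: ennreal_less_iff[OF abs_ge_zero])
    qed
    have "(\<lambda>z. Z / \<psi> y * pt y z) \<in> l1_ball (qs_meas \<mu> \<psi>)"
    proof -
      have "(\<lambda>z. \<bar>Z / \<psi> y * pt y z\<bar>) = (\<lambda>z. Z / \<psi> y * pt y z)"
        using Z psi_pos[of y] mu_pos[of y] by (auto simp: pt_def)
      moreover have "I (\<lambda>z. Z / \<psi> y * pt y z) = Z"
        unfolding I_cmult I_pt using psi_pos[of y] by simp
      ultimately show ?thesis
        unfolding qs_ball_iff Z_def[symmetric] by (simp only: L_cmult[OF pt_L] order_refl simp_thms)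
    qed
    from close[OF this] have "\<bar>Z / \<psi> y * ker n x y / b - 1\<bar> < 1 / 2"
      using Z psi_pos[of y] unfolding Tn_cmult I_cmult I_pt by (simp add: ker_def)
    then have "Z / \<psi> y * ker n x y / b \<le> 2" by linarith
    then have 1: "ker n x y \<le> 2 * b * \<psi> y / Z"
      using Z psi_pos[of y] b by (simp add: field_simps)
    have "(\<lambda>z. Z / I \<phi> * \<phi> z) \<in> l1_ball (qs_meas \<mu> \<psi>)"
    proof -
      have "(\<lambda>z. \<bar>Z / I \<phi> * \<phi> z\<bar>) = (\<lambda>z. Z / I \<phi> * \<phi> z)"
        using Z I_phi_pos phi_pos by (simp add: less_imp_le)
      moreover have "I (\<lambda>z. Z / I \<phi> * \<phi> z) = Z"
        unfolding I_cmult using I_phi_pos by simp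
      ultimately show ?thesis
        unfolding qs_ball_iff Z_def[symmetric] by (simp only: L_cmult[OF phi_L] order_refl simp_thms)
    qed
    from close[OF this] have "\<bar>Z / I \<phi> * (lam ^ n * \<phi> x) / b - 1\<bar> < 1 / 2"
      using Z I_phi_pos unfolding Tn_cmult I_cmult Tn_phi by simp
    then have "1 / 2 \<le> Z / I \<phi> * (lam ^ n * \<phi> x) / b" by linarith
    then have "1 / 2 * b \<le> Z / I \<phi> * (lam ^ n * \<phi> x)"
      using b by (simp only: pos_le_divide_eq)
    then have "b \<le> 2 * (Z / I \<phi> * (lam ^ n * \<phi> x))" by linarith
    then have "2 * b * \<psi> y / Z \<le> 2 * (2 * (Z / I \<phi> * (lam ^ n * \<phi> x))) * \<psi> y / Z"
      using Z psi_pos[of y] by (intro divide_right_mono mult_right_mono mult_left_mono) auto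
    also have "\<dots> = 4 / I \<phi> * lam ^ n * \<phi> x * \<psi> y"
      using Z by simp
    finally show ?thesis using 1 by linarith
  qed
  then show ?thesis
    unfolding pIUC_from_def using I_phi_pos by (intro exI[of _ N] exI[of _ "4 / I \<phi>"]) simp
qed

end

text \<open>From index 2 on the shifted set \<open>A (n - 1)\<close> is contained in
  \<open>A n\<close>, so the same constant serves; \<open>max N 2\<close> also secures a starting
  index of at least 1.\<close>

lemma pIUC_from_shift:
  assumes "exhausting A" "pIUC_from u lam \<phi> \<psi> A N"
  shows "pIUC u lam \<phi> \<psi> (shift_exhaustion A)"
proof -
  obtain c where c: "0 < c" "\<And>n x y. N \<le> n \<Longrightarrow> x \<in> A n \<Longrightarrow> u n x y \<le> c * lam ^ n * \<phi> x * \<psi> y"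
    using assms(2) by (auto simp: pIUC_from_def)
  have shift: "shift_exhaustion A n \<subseteq> A n" if "2 \<le> n" for n
  proof -
    have "shift_exhaustion A n = A (n - 1)" "n = Suc (n - 1)" "1 \<le> n - 1"
      using that by (auto simp: shift_exhaustion_def)
    moreover have "A m \<subseteq> A (Suc m)" if "1 \<le> m" for m
      using assms(1) that by (simp add: exhausting_def)
    ultimately show ?thesis by metis
  qed
  have "pIUC_from u lam \<phi> \<psi> (shift_exhaustion A) (max N 2)"
    unfolding pIUC_from_def
  proof (intro exI[of _ c] conjI c(1) allI impI ballI)
    fix n x y
    assume "max N 2 \<le> n" "x \<in> shift_exhaustion A n"
    then show "u n x y \<le> c * lam ^ n * \<phi> x * \<psi> y"
      using shift[of n] by (intro c(2)) auto
  qed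
  then show ?thesis
    unfolding pIUC_def by (intro exI[of _ "max N 2"]) simp
qed

section \<open>The Feynman-Kac kernel as an instance\<close>

text \<open>Young's inequality bounds \<open>a * \<bar>f\<bar>\<close> by
  \<open>a\<^sup>2 / \<mu> + f\<^sup>2 * \<mu>\<close>, and the density bound turns the first term
  into a multiple of \<open>a\<close>. This makes the sums in the eigenvalue equations truly
  convergent, rather than 0 by default.\<close>

lemma summable_mult_l2:
  fixes a f \<mu> :: "'a \<Rightarrow> real"
  assumes "\<And>y. 0 < \<mu> y" "a summable_on UNIV" "\<And>y. 0 \<le> a y" "\<And>y. a y \<le> M * \<mu> y"
    and "(\<lambda>y. (f y)\<^sup>2 * \<mu> y) summable_on UNIV"
  shows "(\<lambda>y. a y * f y) summable_on UNIV"
proof (rule summable_on_real_bound)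
  show "(\<lambda>y. M * a y + (f y)\<^sup>2 * \<mu> y) summable_on UNIV"
    using assms by (intro summable_on_add summable_on_cmult_right)
next
  fix y
  have "a y * \<bar>f y\<bar> \<le> (a y)\<^sup>2 / \<mu> y + (f y)\<^sup>2 * \<mu> y"
  proof -
    have "0 \<le> (a y - \<bar>f y\<bar> * \<mu> y)\<^sup>2 + a y * \<bar>f y\<bar> * \<mu> y"
      using assms(1,3)[of y] by (intro add_nonneg_nonneg mult_nonneg_nonneg) (auto simp: less_imp_le)
    also have "\<dots> = (a y)\<^sup>2 + (f y)\<^sup>2 * (\<mu> y)\<^sup>2 - a y * \<bar>f y\<bar> * \<mu> y"
      by (simp add: power2_diff power_mult_distrib)
    finally show ?thesis
      using assms(1)[of y] by (simp add: field_simps power2_eq_square)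
  qed
  also have "(a y)\<^sup>2 / \<mu> y \<le> M * a y"
  proof -
    have "a y * a y \<le> a y * (M * \<mu> y)" using assms(3,4)[of y] by (rule mult_left_mono[rotated])
    then show ?thesis using assms(1)[of y] by (simp add: pos_divide_le_eq power2_eq_square mult_ac)
  qed
  finally show "\<bar>a y * f y\<bar> \<le> M * a y + (f y)\<^sup>2 * \<mu> y"
    using assms(3)[of y] by (simp add: abs_mult)
qed

lemma eigen_kernel_fk:
  fixes P Phat :: "'a \<Rightarrow> 'a \<Rightarrow> real"
    and \<mu> V \<phi> \<phi>hat :: "'a \<Rightarrow> real"
    and lam C :: real
  assumes P: "subprob_kernel P" and Phat: "subprob_kernel Phat"
    and mu: "\<And>x. 0 < \<mu> x"
    and adj: "\<And>x y. \<mu> x * P x y = \<mu> y * Phat y x"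
    and V: "potential V"
    and P_pos: "\<And>x y. 0 < P x y"
    and C: "1 \<le> C" "\<And>x y. kernel_comp2 P x y \<le> C * P x y"
    and bdd: "bdd_above (range (\<lambda>(x, y). P x y / \<mu> y))"
    and conf: "confining V"
    and phi: "positive_eigenfunction \<mu> (fk_op P V) lam \<phi>"
    and psi: "positive_eigenfunction \<mu> (fk_op_dual Phat V) lam \<phi>hat"
  shows "\<exists>M. eigen_kernel (\<lambda>x y. P x y / \<mu> y / V x) \<mu> (\<lambda>x. 1 / V x) C M lam \<phi> \<phi>hat"
proof -
  have V_pos: "0 < V x" for x using V by (simp add: potential_def)
  define v where "v = (INF x. V x)"
  have v: "0 < v" using V by (simp add: potential_def v_def)
  have v_le: "v \<le> V x" for x
    unfolding v_def using V_pos by (intro cINF_lower bdd_belowI[of _ 0]) (auto intro: less_imp_le)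
  have Vv: "1 / V x \<le> 1 / v" for x using v_le[of x] v by (simp add: frac_le)
  obtain M where M: "\<And>x y. P x y / \<mu> y \<le> M"
    using bdd by (auto simp: bdd_above_def)
  have M0: "0 \<le> M"
    using M P_pos mu by (meson divide_pos_pos less_imp_le order_trans)
  have P_sum: "P x summable_on UNIV" for x using P by (simp add: subprob_kernel_def)
  have P_le1: "P x y \<le> 1" for x y using P by (simp add: subprob_kernel_def)
  have Ph_sum: "Phat x summable_on UNIV" for x using Phat by (simp add: subprob_kernel_def)
  have Ph_0: "0 \<le> Phat x y" for x y using Phat by (simp add: subprob_kernel_def)
  have P_le: "P x y \<le> M * \<mu> y" for x y using M[of x y] mu[of y] by (simp add: pos_divide_le_eq)
  have Ph_eq: "Phat y x = \<mu> x * P x y / \<mu> y" for x y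
    using adj[of x y] mu[of y] by (simp add: field_simps)
  \<comment> \<open>By adjointness \<open>Phat y x / \<mu> x = P x y / \<mu> y\<close>, so the dual
    density has the same bound \<open>M\<close>.\<close>
  have Ph_le: "Phat y x \<le> M * \<mu> x" for x y
    using mult_right_mono[OF M[of x y], of "\<mu> x"] mu[of x] by (simp add: Ph_eq mult_ac)
  have phi_l2: "(\<lambda>x. (\<phi> x)\<^sup>2 * \<mu> x) summable_on UNIV" and phi_pos: "0 < \<phi> x"
    and phi_eq: "fk_op P V \<phi> x = lam * \<phi> x" for x
    using phi by (auto simp: positive_eigenfunction_def l2_def)
  have psi_l2: "(\<lambda>x. (\<phi>hat x)\<^sup>2 * \<mu> x) summable_on UNIV" and psi_pos: "0 < \<phi>hat x"
    and psi_eq: "fk_op_dual Phat V \<phi>hat x = lam * \<phi>hat x" for x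
    using psi by (auto simp: positive_eigenfunction_def l2_def)
  have "eigen_kernel (\<lambda>x y. P x y / \<mu> y / V x) \<mu> (\<lambda>x. 1 / V x) C (M / v) lam \<phi> \<phi>hat"
  proof
    fix x y :: 'a
    show "0 < \<mu> x" by (rule mu)
    show "0 < 1 / V x" using V_pos by simp
    show "0 < C" using C(1) by simp
    show "0 < \<phi> x" "0 < \<phi>hat x" by (rule phi_pos psi_pos)+
    show "0 < P x y / \<mu> y / V x" using P_pos mu V_pos by simp
    show "P x y / \<mu> y / V x \<le> M / v"
      using M[of x y] v_le[of x] v M0 by (intro frac_le) (auto simp: less_imp_le)
    show "(\<lambda>y. P x y / \<mu> y / V x * \<mu> y) summable_on UNIV"
    proof -
      have "(\<lambda>y. P x y / \<mu> y / V x * \<mu> y) = (\<lambda>y. P x y * (1 / V x))"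
        using mu by (auto simp: less_imp_neq[symmetric])
      then show ?thesis using summable_on_cmult_left[OF P_sum[of x], of "1 / V x"] by simp
    qed
    show "(\<lambda>x. P x y / \<mu> y / V x * \<mu> x) summable_on UNIV"
    proof (rule summable_on_real_bound)
      show "(\<lambda>x. 1 / v * Phat y x) summable_on UNIV" by (intro summable_on_cmult_right Ph_sum)
      fix x
      have "P x y / \<mu> y / V x * \<mu> x = 1 / V x * Phat y x" by (simp add: Ph_eq mult_ac)
      moreover have "1 / V x * Phat y x \<le> 1 / v * Phat y x"
        using Vv Ph_0 by (rule mult_right_mono)
      moreover have "0 \<le> 1 / V x * Phat y x" using V_pos[of x] Ph_0 by simp
      ultimately show "\<bar>P x y / \<mu> y / V x * \<mu> x\<bar> \<le> 1 / v * Phat y x" by simp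
    qed
    show "((\<lambda>y. P x y / \<mu> y / V x * \<phi> y * \<mu> y) has_sum lam * \<phi> x) UNIV"
    proof -
      have "(\<lambda>y. P x y * \<phi> y) summable_on UNIV"
        by (rule summable_mult_l2[OF mu P_sum less_imp_le[OF P_pos] P_le phi_l2])
      then have "((\<lambda>y. 1 / V x * (P x y * \<phi> y)) has_sum 1 / V x * (\<Sum>\<^sub>\<infinity>y. P x y * \<phi> y)) UNIV"
        by (intro has_sum_cmult_right) simp
      moreover have "1 / V x * (\<Sum>\<^sub>\<infinity>y. P x y * \<phi> y) = lam * \<phi> x"
        using phi_eq[of x] by (simp add: fk_op_def)
      moreover have "1 / V x * (P x y * \<phi> y) = P x y / \<mu> y / V x * \<phi> y * \<mu> y" for y
        using mu[of y] by simp
      ultimately show ?thesis by simp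
    qed
    show "((\<lambda>x. P x y / \<mu> y / V x * \<phi>hat x * \<mu> x) has_sum lam * \<phi>hat y) UNIV"
    proof -
      have s: "(\<lambda>x. Phat y x * \<phi>hat x) summable_on UNIV"
        by (rule summable_mult_l2[OF mu Ph_sum Ph_0 Ph_le psi_l2])
      have "(\<lambda>x. Phat y x * (1 / V x) * \<phi>hat x) summable_on UNIV"
      proof (rule summable_on_real_bound)
        show "(\<lambda>x. 1 / v * (Phat y x * \<phi>hat x)) summable_on UNIV" using s by (rule summable_on_cmult_right)
        fix x
        have "0 \<le> Phat y x * \<phi>hat x" using Ph_0 psi_pos[of x] by simp
        then have "1 / V x * (Phat y x * \<phi>hat x) \<le> 1 / v * (Phat y x * \<phi>hat x)"
          by (rule mult_right_mono[OF Vv])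
        moreover have "0 \<le> 1 / V x * (Phat y x * \<phi>hat x)"
          using V_pos[of x] Ph_0[of y x] psi_pos[of x] by simp
        ultimately show "\<bar>Phat y x * (1 / V x) * \<phi>hat x\<bar> \<le> 1 / v * (Phat y x * \<phi>hat x)"
          by simp
      qed
      then have "((\<lambda>x. Phat y x * (1 / V x) * \<phi>hat x) has_sum lam * \<phi>hat y) UNIV"
        using psi_eq[of y] by (simp add: has_sum_iff fk_op_dual_def)
      moreover have "Phat y x * (1 / V x) * \<phi>hat x = P x y / \<mu> y / V x * \<phi>hat x * \<mu> x" for x
        by (simp add: Ph_eq)
      ultimately show ?thesis by simp
    qed
    show "(\<lambda>x. \<phi> x * \<phi>hat x * \<mu> x) summable_on UNIV"
    proof (rule summable_on_real_bound)
      show "(\<lambda>x. (\<phi> x)\<^sup>2 * \<mu> x + (\<phi>hat x)\<^sup>2 * \<mu> x) summable_on UNIV"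
        using phi_l2 psi_l2 by (rule summable_on_add)
      fix x
      have "2 * (\<phi> x * \<phi>hat x) \<le> (\<phi> x)\<^sup>2 + (\<phi>hat x)\<^sup>2"
        using sum_squares_bound[of "\<phi> x" "\<phi>hat x"] by (simp add: mult_ac)
      moreover have "0 < \<phi> x * \<phi>hat x" using phi_pos psi_pos by simp
      ultimately have "\<phi> x * \<phi>hat x * \<mu> x \<le> ((\<phi> x)\<^sup>2 + (\<phi>hat x)\<^sup>2) * \<mu> x"
        using mu[of x] by (intro mult_right_mono) auto
      then show "\<bar>\<phi> x * \<phi>hat x * \<mu> x\<bar> \<le> (\<phi> x)\<^sup>2 * \<mu> x + (\<phi>hat x)\<^sup>2 * \<mu> x"
        using phi_pos[of x] psi_pos[of x] mu[of x] by (simp add: abs_mult distrib_right)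
    qed
  next
    fix e :: real assume e: "0 < e"
    obtain N :: nat where N: "1 / e < real N" using reals_Archimedean2 by blast
    moreover have "0 < 1 / e" using e by simp
    ultimately have "0 < real N" by linarith
    then have "1 \<le> N" by simp
    then obtain B where B: "finite B" "\<And>x. x \<notin> B \<Longrightarrow> real N \<le> V x"
      using conf unfolding confining_def by blast
    have "1 / V x < e" if "x \<notin> B" for x
    proof -
      have "1 / e < V x" using B(2)[OF that] N by linarith
      then show ?thesis using e V_pos[of x] by (simp add: field_simps)
    qed
    then have "{x. e \<le> 1 / V x} \<subseteq> B" by (auto simp: not_le[symmetric])
    then show "finite {x. e \<le> 1 / V x}" using B(1) by (rule finite_subset)
  next
    fix S :: "'a set" and s :: real and x y
    assume s: "\<And>w. w \<in> S \<Longrightarrow> 1 / V w \<le> s" "0 \<le> s"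
    \<comment> \<open>The factor \<open>1 / (V x * \<mu> y)\<close> is common to both sides of
      \<open>two_step\<close>; the middle point contributes \<open>1 / V w\<close>, at most
      \<open>s\<close>, and what remains sums to \<open>kernel_comp2\<close>.\<close>
    define r where "r = s / (V x * \<mu> y)"
    have r: "0 \<le> r" using s(2) V_pos[of x] mu[of y] by (simp add: r_def)
    \<comment> \<open>Convergence here ensures that \<open>kernel_comp2\<close> is a genuine sum and
      not the default 0.\<close>
    have PP: "(\<lambda>w. P x w * P w y) summable_on UNIV"
    proof (rule summable_on_real_bound[OF P_sum[of x]])
      fix w
      show "\<bar>P x w * P w y\<bar> \<le> P x w"
        using P_pos[of x w] P_pos[of w y] P_le1[of w y] by (simp add: abs_mult)
    qed
    have le: "P x w / \<mu> w / V x * (P w y / \<mu> y / V w) * \<mu> w \<le> r * (P x w * P w y)" if "w \<in> S" for w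
    proof -
      have "P x w / \<mu> w / V x * (P w y / \<mu> y / V w) * \<mu> w = 1 / V w * (P x w * P w y / (V x * \<mu> y))"
        using mu[of w] by simp
      also have "\<dots> \<le> s * (P x w * P w y / (V x * \<mu> y))"
        using s(1)[OF that] P_pos[of x w] P_pos[of w y] V_pos[of x] mu[of y]
        by (intro mult_right_mono) auto
      finally show ?thesis by (simp add: r_def)
    qed
    have ge: "0 \<le> P x w / \<mu> w / V x * (P w y / \<mu> y / V w) * \<mu> w" for w
      using P_pos[of x w] P_pos[of w y] V_pos[of x] V_pos[of w] mu[of y] mu[of w] by simp
    have rs: "(\<lambda>w. r * (P x w * P w y)) summable_on UNIV" using PP by (rule summable_on_cmult_right)
    have "(\<Sum>\<^sub>\<infinity>w\<in>S. P x w / \<mu> w / V x * (P w y / \<mu> y / V w) * \<mu> w) \<le> (\<Sum>\<^sub>\<infinity>w. r * (P x w * P w y))"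
    proof (rule infsum_mono_neutral)
      show "(\<lambda>w. P x w / \<mu> w / V x * (P w y / \<mu> y / V w) * \<mu> w) summable_on S"
        by (rule summable_on_real_bound[OF summable_on_subset_banach[OF rs]])
          (use le ge in \<open>simp_all only: abs_of_nonneg subset_UNIV\<close>)
    qed (use rs le r P_pos in \<open>auto simp: less_imp_le\<close>)
    also have "\<dots> = r * kernel_comp2 P x y"
      by (simp add: kernel_comp2_def infsum_cmult_right')
    also have "\<dots> \<le> r * (C * P x y)" using C(2) r by (rule mult_left_mono)
    finally show "(\<Sum>\<^sub>\<infinity>w\<in>S. P x w / \<mu> w / V x * (P w y / \<mu> y / V w) * \<mu> w) \<le> C * s * (P x y / \<mu> y / V x)"
      by (simp add: r_def mult_ac)
  qed
  then show ?thesis ..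
qed

section \<open>Both semigroups as dual instances\<close>

theorem theorem6p5:
  fixes P Phat :: "'a \<Rightarrow> 'a \<Rightarrow> real"
    and \<mu> V \<phi> \<phi>hat :: "'a \<Rightarrow> real"
    and lam0 C :: real
  assumes "countable (UNIV :: 'a set)" and "infinite (UNIV :: 'a set)"
    and "subprob_kernel P" and "subprob_kernel Phat"
    and "\<And>x. 0 < \<mu> x"
    and "\<And>x y. \<mu> x * P x y = \<mu> y * Phat y x"
    and "potential V"
    and "\<And>x y. 0 < P x y"
    and "1 \<le> C" and "\<And>x y. kernel_comp2 P x y \<le> C * P x y"
    and "bdd_above (range (\<lambda>(x, y). P x y / \<mu> y))"
    and "confining V"
    and "lam0 = spectral_radius_l2 \<mu> (fk_op P V)"
    and "positive_eigenfunction \<mu> (fk_op P V) lam0 \<phi>"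
    and "positive_eigenfunction \<mu> (fk_op_dual Phat V) lam0 \<phi>hat"
  shows
    "(\<forall>n0 A. 1 \<le> n0 \<and> exhausting A
        \<and> pIUC_from (fk_kernel P \<mu> V) lam0 \<phi> \<phi>hat A n0
        \<and> pIUC_from (fk_kernel_dual P \<mu> V) lam0 \<phi>hat \<phi> A n0 \<longrightarrow>
       (\<exists>C1>0. \<exists>C2>0. \<exists>\<rho>. 0 < \<rho> \<and> \<rho> < 1 \<and>
          (\<forall>n k l j. 2 * n0 + 1 < n \<and> n0 \<le> l \<and> n0 \<le> j \<and> k + l + j = n - 1 \<longrightarrow>
             intrinsic_dist (fk_op P V) lam0 \<phi> (nu_meas \<mu> \<phi> \<phi>hat) n (A l)
               \<le> ennreal C1 * ((SUP z\<in>- A j. ennreal (1 / V z)) + ennreal (\<rho> ^ k)) \<and>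
             qs_dist (fk_op P V) (qs_meas \<mu> \<phi>hat) n (A l)
               \<le> ennreal C2 * ((SUP z\<in>- A j. ennreal (1 / V z)) + ennreal (\<rho> ^ k)))) \<and>
       (\<exists>C1>0. \<exists>C2>0. \<exists>\<rho>. 0 < \<rho> \<and> \<rho> < 1 \<and>
          (\<forall>n k l j. 2 * n0 + 1 < n \<and> n0 \<le> l \<and> n0 \<le> j \<and> k + l + j = n - 1 \<longrightarrow>
             intrinsic_dist (fk_op_dual Phat V) lam0 \<phi>hat (nu_meas \<mu> \<phi> \<phi>hat) n (A l)
               \<le> ennreal C1 * ((SUP z\<in>- A j. ennreal (1 / V z)) + ennreal (\<rho> ^ k)) \<and>
             qs_dist (fk_op_dual Phat V) (qs_meas \<mu> \<phi>) n (A l)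
               \<le> ennreal C2 * ((SUP z\<in>- A j. ennreal (1 / V z)) + ennreal (\<rho> ^ k)))))
     \<and>
     (\<forall>A. exhausting A \<longrightarrow>
       ((\<lambda>n. intrinsic_dist (fk_op P V) lam0 \<phi> (nu_meas \<mu> \<phi> \<phi>hat) n (A n)) \<longlonglongrightarrow> 0 \<or>
        (\<lambda>n. qs_dist (fk_op P V) (qs_meas \<mu> \<phi>hat) n (A n)) \<longlonglongrightarrow> 0 \<longrightarrow>
          pIUC (fk_kernel P \<mu> V) lam0 \<phi> \<phi>hat (shift_exhaustion A)) \<and>
       ((\<lambda>n. intrinsic_dist (fk_op_dual Phat V) lam0 \<phi>hat (nu_meas \<mu> \<phi> \<phi>hat) n (A n)) \<longlonglongrightarrow> 0 \<or>
        (\<lambda>n. qs_dist (fk_op_dual Phat V) (qs_meas \<mu> \<phi>) n (A n)) \<longlonglongrightarrow> 0 \<longrightarrow>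
          pIUC (fk_kernel_dual P \<mu> V) lam0 \<phi>hat \<phi> (shift_exhaustion A)))"
proof -
  note mu = assms(5) and adj = assms(6)
  obtain M where "eigen_kernel (\<lambda>x y. P x y / \<mu> y / V x) \<mu> (\<lambda>x. 1 / V x) C M lam0 \<phi> \<phi>hat"
    using eigen_kernel_fk[OF assms(3-12) assms(14,15)] by blast
  then interpret U: eigen_kernel "\<lambda>x y. P x y / \<mu> y / V x" \<mu> "\<lambda>x. 1 / V x" C M lam0 \<phi> \<phi>hat .
  \<comment> \<open>The dual assertions are those of (a) and (b) for the transposed kernel, whose
    operator is identified with \<open>fk_op_dual Phat V\<close> through adjointness.\<close>
  interpret D: eigen_kernel "\<lambda>x y. P y x / \<mu> x / V y" \<mu> "\<lambda>x. 1 / V x" C M lam0 \<phi>hat \<phi>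
    by (rule U.dual)
  have UT: "U.T = fk_op P V"
  proof (intro ext)
    fix f x
    have "P x y / \<mu> y / V x * f y * \<mu> y = 1 / V x * (P x y * f y)" for y
      using mu[of y] by simp
    then show "U.T f x = fk_op P V f x"
      by (simp only: U.T_def fk_op_def infsum_cmult_right' real_scaleR_def)
  qed
  have DT: "D.T = fk_op_dual Phat V"
  proof (intro ext)
    fix f x
    have "Phat x y = \<mu> y * P y x / \<mu> x" for y
      using adj[of y x] mu[of x] by (simp add: field_simps)
    then have "P y x / \<mu> x / V y * f y * \<mu> y = Phat x y * (1 / V y) * f y" for y
      by (simp add: mult_ac)
    then show "D.T f x = fk_op_dual Phat V f x"
      by (simp only: D.T_def fk_op_dual_def real_scaleR_def)
  qed
  \<comment> \<open>\<open>fk_kernel\<close> has a separate clause for one step, so the induction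
    step distinguishes \<open>n = 0\<close>; for longer times both sides satisfy the recursion from
    the right.\<close>
  have Uker: "U.ker n x y = fk_kernel P \<mu> V n x y" for n x y
  proof (induction n arbitrary: y)
    case 0
    show ?case unfolding U.ker_def U.pt_def by simp
  next
    case (Suc n)
    show ?case
    proof (cases n)
      case 0
      show ?thesis unfolding 0 U.ker_Suc by simp
    next
      case (Suc m)
      show ?thesis
        unfolding U.ker_Suc' Suc.IH by (simp add: Suc)
    qed
  qed
  have U: "U.ker = fk_kernel P \<mu> V" "(\<lambda>n x y. fk_kernel P \<mu> V n y x) = fk_kernel_dual P \<mu> V"
    by (intro ext, simp only: Uker fk_kernel_dual_def)+
  have D: "D.ker = fk_kernel_dual P \<mu> V" "(\<lambda>n x y. fk_kernel_dual P \<mu> V n y x) = fk_kernel P \<mu> V"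
    by (intro ext, simp only: U.dual_ker Uker fk_kernel_dual_def)+
  have nu: "nu_meas \<mu> \<phi>hat \<phi> = nu_meas \<mu> \<phi> \<phi>hat"
    by (simp add: fun_eq_iff nu_meas_def mult_ac)
  show ?thesis
  proof (intro conjI allI impI)
    fix n0 A
    assume A: "1 \<le> n0 \<and> exhausting A
        \<and> pIUC_from (fk_kernel P \<mu> V) lam0 \<phi> \<phi>hat A n0
        \<and> pIUC_from (fk_kernel_dual P \<mu> V) lam0 \<phi>hat \<phi> A n0"
    show "\<exists>C1>0. \<exists>C2>0. \<exists>\<rho>. 0 < \<rho> \<and> \<rho> < 1 \<and>
          (\<forall>n k l j. 2 * n0 + 1 < n \<and> n0 \<le> l \<and> n0 \<le> j \<and> k + l + j = n - 1 \<longrightarrow>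
             intrinsic_dist (fk_op P V) lam0 \<phi> (nu_meas \<mu> \<phi> \<phi>hat) n (A l)
               \<le> ennreal C1 * ((SUP z\<in>- A j. ennreal (1 / V z)) + ennreal (\<rho> ^ k)) \<and>
             qs_dist (fk_op P V) (qs_meas \<mu> \<phi>hat) n (A l)
               \<le> ennreal C2 * ((SUP z\<in>- A j. ennreal (1 / V z)) + ennreal (\<rho> ^ k)))"
      using A by (intro U.pIUC_convergence[unfolded UT U]) auto
    show "\<exists>C1>0. \<exists>C2>0. \<exists>\<rho>. 0 < \<rho> \<and> \<rho> < 1 \<and>
          (\<forall>n k l j. 2 * n0 + 1 < n \<and> n0 \<le> l \<and> n0 \<le> j \<and> k + l + j = n - 1 \<longrightarrow>
             intrinsic_dist (fk_op_dual Phat V) lam0 \<phi>hat (nu_meas \<mu> \<phi> \<phi>hat) n (A l)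
               \<le> ennreal C1 * ((SUP z\<in>- A j. ennreal (1 / V z)) + ennreal (\<rho> ^ k)) \<and>
             qs_dist (fk_op_dual Phat V) (qs_meas \<mu> \<phi>) n (A l)
               \<le> ennreal C2 * ((SUP z\<in>- A j. ennreal (1 / V z)) + ennreal (\<rho> ^ k)))"
      using A by (intro D.pIUC_convergence[unfolded DT D nu]) auto
  next
    fix A :: "nat \<Rightarrow> 'a set"
    assume "exhausting A" and
      "(\<lambda>n. intrinsic_dist (fk_op P V) lam0 \<phi> (nu_meas \<mu> \<phi> \<phi>hat) n (A n)) \<longlonglongrightarrow> 0 \<or>
       (\<lambda>n. qs_dist (fk_op P V) (qs_meas \<mu> \<phi>hat) n (A n)) \<longlonglongrightarrow> 0"
    then show "pIUC (fk_kernel P \<mu> V) lam0 \<phi> \<phi>hat (shift_exhaustion A)"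
      using U.intrinsic_dist_pIUC[unfolded UT U, of A] U.qs_dist_pIUC[unfolded UT U, of A]
        pIUC_from_shift by blast
  next
    fix A :: "nat \<Rightarrow> 'a set"
    assume "exhausting A" and
      "(\<lambda>n. intrinsic_dist (fk_op_dual Phat V) lam0 \<phi>hat (nu_meas \<mu> \<phi> \<phi>hat) n (A n)) \<longlonglongrightarrow> 0 \<or>
       (\<lambda>n. qs_dist (fk_op_dual Phat V) (qs_meas \<mu> \<phi>) n (A n)) \<longlonglongrightarrow> 0"
    then show "pIUC (fk_kernel_dual P \<mu> V) lam0 \<phi>hat \<phi> (shift_exhaustion A)"
      using D.intrinsic_dist_pIUC[unfolded DT D nu, of A] D.qs_dist_pIUC[unfolded DT D nu, of A]
        pIUC_from_shift by blast
  qed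
qed

end
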